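(* Let $2\le n\le N$ and let $\{(X_k^{(n)},T_k^{(n)}),k\ge 0\}$ be a Markov renewal process with state space $S_n=\{1,2,\dots,n\}$, irreducible transition matrix $P^{(n)}=[p_{ij}^{(n)}]$, mean first passage time matrix $M_n=[m_{ij}]_{1\le i,j\le n}$ and vector of mean holding times $\boldsymbol{\mu}^{(n)T}=(\mu_1^{(n)},\dots,\mu_n^{(n)})$. Then $$(I_n-P^{(n)})M_n=\boldsymbol{\mu}^{(n)}\boldsymbol{e}^{(n)T}-P^{(n)}(M_n)_d,$$ or, in element form, $m_{ij}=\mu_i^{(n)}+\sum_{k=1,k\ne j}^{n}p_{ik}^{(n)}m_{kj}$ for $1\le i\le n$, $1\le j\le n$. Moreover, the process $\{(X_k^{(n-1)},T_k^{(n-1)}),k\ge 0\}$ obtained by the state reduction (removal of state $n$) is also a Markov renewal process, with state space $S_{n-1}=\{1,\dots,n-1\}$, transition matrix $P^{(n-1)}=[p_{ij}^{(n-1)}]$, vector of mean holding times $\boldsymbol{\mu}^{(n-1)T}=(\mu_1^{(n-1)},\dots,\mu_{n-1}^{(n-1)})$, and mean first passage time matrix $M_{n-1}=[m_{ij}]_{1\le i,j\le n-1}$ (with the same entries $m_{ij}$ as in $M_n$), which satisfies $$(I_{n-1}-P^{(n-1)})M_{n-1}=\boldsymbol{\mu}^{(n-1)}\boldsymbol{e}^{(n-1)T}-P^{(n-1)}(M_{n-1})_d,$$ where $$p_{ij}^{(n-1)}=p_{ij}^{(n)}+\frac{p_{in}^{(n)}p_{nj}^{(n)}}{S(n)},\quad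 1\le i\le n-1,\ 1\le j\le n-1,$$ $$\mu_i^{(n-1)}=\mu_i^{(n)}+\frac{p_{in}^{(n)}\mu_n^{(n)}}{S(n)},\quad 1\le i\le n-1,$$ and $S(n)=\sum_{j=1}^{n-1}p_{nj}^{(n)}=1-p_{nn}^{(n)}$.
   Context: A Markov renewal process (MRP) $\{(X_k,T_k),k\ge0\}$ on a finite state space $S$ has a semi-Markov kernel $Q_{ij}(t)=P\{X_{k+1}=j,\,T_{k+1}-T_k\le t\mid X_k=i\}$; $X_k$ is the state visited and $T_k$ the time of the $k$-th transition (with $T_0=0$ for the original process). Its transition matrix is that of the embedded Markov chain $\{X_k\}$, $p_{ij}=Q_{ij}(+\infty)$ (self-transitions $p_{ii}>0$ are allowed). The mean holding time in state $i$ is $\mu_i=E[T_{k+1}-T_k\mid X_k=i]=\sum_j\int_0^\infty t\,dQ_{ij}(t)$, assumed finite. The embedded chain is assumed irreducible. The mean first passage time $m_{ij}$ is the expected time $E[T_\kappa-T_0\mid X_0=i]$ with $\kappa=\min\{k\ge1:X_k=j\}$ (for $i=j$ it is the mean recurrence time). For a square matrix $A$, $A_d$ denotes the diagonal matrix with the same diagonal as $A$; $\boldsymbol{e}^{(n)}$ is the $n\times1$ vector of ones and $I_n$ the $n\times n$ identity. State reduction: the reduced process on $S_{n-1}$ is the process restricted to ("censored" on) $S_{n-1}$, i.e. if $k_0<k_1<\cdots$ are the successive indices $k$ with $X_k^{(n)}\neq n$, then $X_j^{(n-1)}=X_{k_j}^{(n)}$ and $T_j^{(n-1)}=T_{k_j}^{(n)}$.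 *)

theory Defs
  imports "HOL-Probability.Probability" "HOL-Library.Infinite_Set" "Jordan_Normal_Form.Matrix"
begin

definition semi_markov_kernel :: "'s set \<Rightarrow> ('s \<Rightarrow> 's \<Rightarrow> real \<Rightarrow> real) \<Rightarrow> bool" where
  "semi_markov_kernel S Q \<longleftrightarrow>
     (\<forall>i\<in>S. \<forall>j\<in>S. mono (Q i j) \<and> (\<forall>t. continuous (at_right t) (Q i j)) \<and> (\<forall>t<0. Q i j t = 0)) \<and>
     (\<forall>i\<in>S. ((\<lambda>t. \<Sum>j\<in>S. Q i j t) \<longlongrightarrow> 1) at_top)"

definition transition_prob :: "('s \<Rightarrow> 's \<Rightarrow> real \<Rightarrow> real) \<Rightarrow> 's \<Rightarrow> 's \<Rightarrow> real" where
  "transition_prob Q i j = Lim at_top (Q i j)"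

text \<open>The Lebesgue--Stieltjes integrals are taken in the extended non-negative reals, so that
  finiteness of the mean is expressed by \<open>mean_holding_time S Q i \<noteq> \<infinity>\<close>.\<close>

definition mean_holding_time :: "'s set \<Rightarrow> ('s \<Rightarrow> 's \<Rightarrow> real \<Rightarrow> real) \<Rightarrow> 's \<Rightarrow> ennreal" where
  "mean_holding_time S Q i = (\<Sum>j\<in>S. \<integral>\<^sup>+t\<in>{0..}. ennreal t \<partial>interval_measure (Q i j))"

definition process_history ::
    "'w measure \<Rightarrow> (nat \<Rightarrow> 'w \<Rightarrow> 's) \<Rightarrow> (nat \<Rightarrow> 'w \<Rightarrow> real) \<Rightarrow> nat \<Rightarrow> 'w measure" where
  "process_history M X T k = sigma (space M)
     ({X l -` {x} \<inter> space M |l x. l \<le> k} \<union> {T l -` B \<inter> space M |l B. l \<le> k \<and> B \<in> sets borel})"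

text \<open>The initial distribution of \<open>X 0\<close> and the initial time \<open>T 0\<close> are arbitrary: after a state
  reduction the first visit to the remaining states need not occur at time 0.
  The process is only required to live in \<open>S\<close> almost surely.\<close>

locale markov_renewal_process = prob_space M
  for M :: "'w measure" +
  fixes S :: "'s set"
    and Q :: "'s \<Rightarrow> 's \<Rightarrow> real \<Rightarrow> real"
    and X :: "nat \<Rightarrow> 'w \<Rightarrow> 's"
    and T :: "nat \<Rightarrow> 'w \<Rightarrow> real"
  assumes finite_state_space: "finite S"
    and kernel: "semi_markov_kernel S Q"
    and X_measurable: "\<And>k. X k \<in> measurable M (count_space UNIV)"
    and T_measurable: "\<And>k. T k \<in> borel_measurable M"
    and X_in_S: "\<And>k. AE \<omega> in M. X k \<omega> \<in> S"
    and T_mono: "\<And>k. AE \<omega> in M. T k \<omega> \<le> T (Suc k) \<omega>"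
    and markov_renewal_property: "\<And>k j t. j \<in> S \<Longrightarrow>
      AE \<omega> in M. real_cond_exp M (process_history M X T k)
        (indicator {\<omega> \<in> space M. X (Suc k) \<omega> = j \<and> T (Suc k) \<omega> - T k \<omega> \<le> t}) \<omega> = Q (X k \<omega>) j t"

text \<open>\<open>T\<^sub>\<kappa> - T\<^sub>0\<close> with \<open>\<kappa> = min {k \<ge> 1. X\<^sub>k = j}\<close>, and \<open>\<infinity>\<close> on paths that never reach \<open>j\<close>.\<close>

definition first_passage_time ::
    "(nat \<Rightarrow> 'w \<Rightarrow> 's) \<Rightarrow> (nat \<Rightarrow> 'w \<Rightarrow> real) \<Rightarrow> 's \<Rightarrow> 'w \<Rightarrow> ennreal" where
  "first_passage_time X T j \<omega> =
     (if \<exists>k\<ge>1. X k \<omega> = j then ennreal (T (LEAST k. k \<ge> 1 \<and> X k \<omega> = j) \<omega> - T 0 \<omega>) else \<infinity>)"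

text \<open>Expectation under the conditional measure given \<open>X 0 = i\<close>; meaningful when this event has
  positive probability.\<close>

definition mean_first_passage_time ::
    "'w measure \<Rightarrow> (nat \<Rightarrow> 'w \<Rightarrow> 's) \<Rightarrow> (nat \<Rightarrow> 'w \<Rightarrow> real) \<Rightarrow> 's \<Rightarrow> 's \<Rightarrow> ennreal" where
  "mean_first_passage_time M X T i j =
     (\<integral>\<^sup>+\<omega>. first_passage_time X T j \<omega> \<partial>uniform_measure M {\<omega> \<in> space M. X 0 \<omega> = i})"

text \<open>The successive indices \<open>k\<^sub>0 < k\<^sub>1 < \<dots>\<close> at which the process is not in state \<open>s\<close>.\<close>

definition reduction_index :: "'s \<Rightarrow> (nat \<Rightarrow> 'w \<Rightarrow> 's) \<Rightarrow> nat \<Rightarrow> 'w \<Rightarrow> nat" where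
  "reduction_index s X j \<omega> = enumerate {k. X k \<omega> \<noteq> s} j"

definition reduced_X :: "'s \<Rightarrow> (nat \<Rightarrow> 'w \<Rightarrow> 's) \<Rightarrow> nat \<Rightarrow> 'w \<Rightarrow> 's" where
  "reduced_X s X j \<omega> = X (reduction_index s X j \<omega>) \<omega>"

definition reduced_T ::
    "'s \<Rightarrow> (nat \<Rightarrow> 'w \<Rightarrow> 's) \<Rightarrow> (nat \<Rightarrow> 'w \<Rightarrow> real) \<Rightarrow> nat \<Rightarrow> 'w \<Rightarrow> real" where
  "reduced_T s X T j \<omega> = T (reduction_index s X j \<omega>) \<omega>"

text \<open>States are numbered from 1, matrix and vector indices from 0.\<close>

definition transition_matrix :: "nat \<Rightarrow> (nat \<Rightarrow> nat \<Rightarrow> real \<Rightarrow> real) \<Rightarrow> real mat" where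
  "transition_matrix n Q = Matrix.mat n n (\<lambda>(i, j). transition_prob Q (Suc i) (Suc j))"

definition holding_time_vec :: "nat \<Rightarrow> (nat \<Rightarrow> nat \<Rightarrow> real \<Rightarrow> real) \<Rightarrow> real Matrix.vec" where
  "holding_time_vec n Q = Matrix.vec n (\<lambda>i. enn2real (mean_holding_time {1..n} Q (Suc i)))"

definition first_passage_matrix ::
    "nat \<Rightarrow> 'w measure \<Rightarrow> (nat \<Rightarrow> 'w \<Rightarrow> nat) \<Rightarrow> (nat \<Rightarrow> 'w \<Rightarrow> real) \<Rightarrow> real mat" where
  "first_passage_matrix n M X T =
     Matrix.mat n n (\<lambda>(i, j). enn2real (mean_first_passage_time M X T (Suc i) (Suc j)))"

definition ones_vec :: "nat \<Rightarrow> real Matrix.vec" where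
  "ones_vec n = Matrix.vec n (\<lambda>_. 1)"

definition outer_product :: "real Matrix.vec \<Rightarrow> real Matrix.vec \<Rightarrow> real mat" where
  "outer_product u v = mat_of_cols (dim_vec u) [u] * mat_of_rows (dim_vec v) [v]"

definition diag_part :: "real mat \<Rightarrow> real mat" where
  "diag_part A = mat_diag (dim_row A) (\<lambda>i. A $$ (i, i))"

definition irreducible_matrix :: "real mat \<Rightarrow> bool" where
  "irreducible_matrix P \<longleftrightarrow> (\<forall>i<dim_row P. \<forall>j<dim_row P. \<exists>k. (P ^\<^sub>m k) $$ (i, j) > 0)"

end

theory Submission
  imports Defs
begin

text \<open>
  On a history event contained in \<open>X\<^sub>r = i\<close>, the pair of next state and holding time has law
  \<open>Q\<^sub>i\<close>. Writing \<open>T\<^sub>\<kappa> - T\<^sub>0\<close> as a sum of holding times up to \<open>\<kappa>\<close> therefore gives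
  \<open>m\<^sub>i\<^sub>j = \<Sum>\<^sub>k (P\<^sub>j\<^sup>k \<mu>)\<^sub>i\<close>, where \<open>P\<^sub>j\<close> is \<open>P\<close> with column \<open>j\<close> deleted. This series is the
  least nonnegative solution of \<open>x = \<mu> + P\<^sub>j x\<close>; it is finite because irreducibility yields a
  finite supersolution, and the same bound makes every state recurrent.

  For the reduction, the time spent on an excursion through the removed state \<open>s\<close> with \<open>m\<close>
  visits is a convolution of \<open>m + 1\<close> step laws, and the kernel of the reduced process sums these
  over \<open>m\<close>; its masses and means come from geometric series with ratio \<open>p\<^sub>s\<^sub>s < 1\<close>. The Markov
  renewal property follows by splitting over the step at which the \<open>k\<close>-th visit outside \<open>s\<close>
  occurs and the length of the following excursion. Since \<open>X 0\<close> may be \<open>s\<close>, the events \<open>X 0 = i\<close>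
  and \<open>X' 0 = i\<close> differ, so the passage times of both processes are compared through minimality
  of the series: eliminating \<open>s\<close> carries solutions of one linear system to the other.
\<close>

subsection \<open>Sums of measures, convolution and enumeration\<close>

text \<open>The hypothesis controls a single step at a deterministic time, whereas the index of the
  \<open>k\<close>-th visit outside \<open>s\<close> is random. A strong Markov argument is
  therefore replaced by sums over deterministic indices. Conditioning is never normalised: a
  statement about a history event \<open>A\<close> carries the factor \<open>emeasure M A\<close>,
  so null events need no separate care.

  Series are summed in \<open>ennreal\<close>, where exchanging sums and integrals is free but
  cancellation is not: an infinite value can satisfy a first-passage equation as well. Finiteness
  thus has to be earned before an equation determines anything. The supersolution that provides it
  is a multiple of \<open>\<Sum>k<K. avoid j k i\<close>, with \<open>K\<close> so large that from
  every state \<open>j\<close> is met within \<open>K\<close> steps with positive probability.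

  The reduced process is therefore not made an instance of it: its recurrence comes from the paths
  of the original process, and the finiteness of its passage times from comparison with the original
  series.\<close>

lemma ennreal_suminf_split_head:
  fixes f :: "nat \<Rightarrow> ennreal"
  shows "(\<Sum>n. f n) = f 0 + (\<Sum>n. f (Suc n))"
proof -
  have "f sums ((\<Sum>n. f (Suc n)) + f 0)"
    by (intro sums_Suc summable_sums summableI)
  then show ?thesis
    by (simp add: sums_unique[symmetric] add.commute)
qed

text \<open>For \<open>q > 0\<close> the equation \<open>x = b + q * x\<close> also has the solution
  infinity, so the sum is bounded before the equation is solved: \<open>b / (1 - q)\<close> is the
  real fixed point, and the partial sums stay below it by induction. Later \<open>q\<close> is the
  self-transition probability of the removed state.\<close>

lemma ennreal_affine_series:
  fixes a c :: "nat \<Rightarrow> ennreal"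
  assumes rec: "\<And>m. a (Suc m) = c m + ennreal q * a m"
    and q: "0 \<le> q" "q < 1"
    and fin: "a 0 + (\<Sum>m. c m) \<noteq> \<infinity>"
  shows "(\<Sum>m. a m) = ennreal (enn2real (a 0 + (\<Sum>m. c m)) / (1 - q))"
proof -
  define b where "b = enn2real (a 0 + (\<Sum>m. c m))"
  have b: "a 0 + (\<Sum>m. c m) = ennreal b" "b \<ge> 0"
    using fin by (auto simp: b_def ennreal_enn2real_if)
  have part: "(\<Sum>m<K. a m) \<le> ennreal (b / (1 - q))" for K
  proof (induction K)
    case (Suc K)
    have "(\<Sum>m<Suc K. a m) = a 0 + (\<Sum>m<K. a (Suc m))"
      by (rule sum.lessThan_Suc_shift)
    also have "\<dots> = a 0 + (\<Sum>m<K. c m) + ennreal q * (\<Sum>m<K. a m)"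
      by (simp add: rec sum.distrib sum_distrib_left add.assoc)
    also have "\<dots> \<le> ennreal b + ennreal q * ennreal (b / (1 - q))"
      unfolding b(1)[symmetric]
      by (intro add_mono mult_left_mono Suc sum_le_suminf summableI) auto
    also have "\<dots> = ennreal (b + q * (b / (1 - q)))"
      using b q by (simp flip: ennreal_mult' ennreal_plus)
    also have "b + q * (b / (1 - q)) = b / (1 - q)"
      using q by (simp add: field_simps)
    finally show ?case .
  qed simp
  have "(\<Sum>m. a m) \<le> ennreal (b / (1 - q))"
    by (intro suminf_le_const summableI part)
  then have "(\<Sum>m. a m) \<noteq> \<infinity>"
    by (auto simp: top_unique)
  then obtain x where x: "(\<Sum>m. a m) = ennreal x" "x \<ge> 0"
    by (cases "\<Sum>m. a m") auto
  have "(\<Sum>m. a m) = a 0 + (\<Sum>m. a (Suc m))"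
    by (rule ennreal_suminf_split_head)
  also have "(\<Sum>m. a (Suc m)) = (\<Sum>m. c m) + ennreal q * (\<Sum>m. a m)"
    unfolding rec by (subst suminf_add[symmetric]) (auto intro: summableI)
  finally have "ennreal x = ennreal b + ennreal q * ennreal x"
    by (simp add: x b(1)[symmetric] add.assoc)
  also have "\<dots> = ennreal (b + q * x)"
    using x b q by (simp flip: ennreal_mult' ennreal_plus)
  finally have "x = b + q * x"
    using x b q by (subst (asm) ennreal_inj) auto
  then have "x = b / (1 - q)"
    using q by (simp add: field_simps)
  then show ?thesis
    using x by (simp add: b_def)
qed

section \<open>Countable sums and convolutions of measures on the line\<close>

definition sum_measure :: "(nat \<Rightarrow> real measure) \<Rightarrow> real measure" where
  "sum_measure \<nu> = measure_of UNIV (sets borel) (\<lambda>B. \<Sum>m. emeasure (\<nu> m) B)"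

lemma sets_sum_measure [simp, measurable_cong]: "sets (sum_measure \<nu>) = sets borel"
  and space_sum_measure [simp]: "space (sum_measure \<nu>) = UNIV"
  unfolding sum_measure_def
   apply (metis sets.sets_measure_of_eq space_borel)
  by (metis space_borel space_measure_of_conv)

lemma emeasure_sum_measure:
  assumes [simp]: "\<And>m. sets (\<nu> m) = sets borel" and B: "B \<in> sets borel"
  shows "emeasure (sum_measure \<nu>) B = (\<Sum>m. emeasure (\<nu> m) B)"
  unfolding sum_measure_def
proof (rule emeasure_measure_of_sigma)
  show "B \<in> sets borel" by fact
  show "sigma_algebra UNIV (sets (borel :: real measure))"
    by (metis sets.sigma_algebra_axioms space_borel)
  show "positive (sets borel) (\<lambda>B. \<Sum>m. emeasure (\<nu> m) B)"
    by (simp add: positive_def)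
  show "countably_additive (sets borel) (\<lambda>B. \<Sum>m. emeasure (\<nu> m) B)"
  proof (rule countably_additiveI)
    fix A :: "nat \<Rightarrow> real set"
    assume A: "range A \<subseteq> sets borel" "disjoint_family A"
    \<comment> \<open>The two series are exchanged by reading one of them as an integral over
      counting measure.\<close>
    have "(\<Sum>i. \<Sum>m. emeasure (\<nu> m) (A i)) =
        (\<Sum>i. \<integral>\<^sup>+m. emeasure (\<nu> m) (A i) \<partial>count_space UNIV)"
      by (simp only: nn_integral_count_space_nat)
    also have "\<dots> = (\<integral>\<^sup>+m. (\<Sum>i. emeasure (\<nu> m) (A i)) \<partial>count_space UNIV)"
      by (rule nn_integral_suminf[symmetric]) simp
    also have "\<dots> = (\<Sum>m. \<Sum>i. emeasure (\<nu> m) (A i))"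
      by (simp only: nn_integral_count_space_nat)
    also have "\<dots> = (\<Sum>m. emeasure (\<nu> m) (\<Union>i. A i))"
      using A by (intro suminf_cong suminf_emeasure) auto
    finally show "(\<Sum>i. \<Sum>m. emeasure (\<nu> m) (A i)) = (\<Sum>m. emeasure (\<nu> m) (\<Union> (range A)))"
      by simp
  qed
qed

lemma nn_integral_sum_measure:
  assumes [simp, measurable_cong]: "\<And>m. sets (\<nu> m) = sets borel"
    and f: "f \<in> borel_measurable borel"
  shows "(\<integral>\<^sup>+x. f x \<partial>sum_measure \<nu>) = (\<Sum>m. \<integral>\<^sup>+x. f x \<partial>\<nu> m)"
  using f
proof (induction rule: borel_measurable_induct)
  case (cong f g)
  have "f = g" using cong by auto
  with cong show ?case by simp
next
  case (set A)
  then show ?case by (simp add: emeasure_sum_measure)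
next
  case (mult u v)
  then show ?case by (simp add: nn_integral_cmult)
next
  case (add u v)
  then show ?case
    by (simp add: nn_integral_add suminf_add[symmetric] summableI)
next
  case (seq U)
  have [measurable]: "U i \<in> borel_measurable borel" for i
    by (rule seq)
  have "(\<integral>\<^sup>+x. (SUP i. U i) x \<partial>sum_measure \<nu>) = (SUP i. \<integral>\<^sup>+x. U i x \<partial>sum_measure \<nu>)"
    using seq by (simp add: nn_integral_monotone_convergence_SUP image_comp)
  also have "\<dots> = (SUP i. \<Sum>m. \<integral>\<^sup>+x. U i x \<partial>\<nu> m)"
    using seq by simp
  also have "\<dots> = (\<Sum>m. SUP i. \<integral>\<^sup>+x. U i x \<partial>\<nu> m)"
    using seq(3) by (intro ennreal_suminf_SUP_eq[symmetric])
      (auto simp: incseq_def le_fun_def intro!: nn_integral_mono)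
  also have "\<dots> = (\<Sum>m. \<integral>\<^sup>+x. (SUP i. U i) x \<partial>\<nu> m)"
    using seq by (simp add: nn_integral_monotone_convergence_SUP image_comp)
  finally show ?case by simp
qed

text \<open>Expectation of a sum of independent times, with the total masses as factors because the
  measures are not normalised. Nonnegativity is what lets \<open>ennreal (x + y)\<close>
  split.\<close>

lemma nn_integral_ennreal_convolution:
  assumes fin: "finite_measure \<mu>" "finite_measure \<nu>"
    and [simp, measurable_cong]: "sets \<mu> = sets borel" "sets \<nu> = sets borel"
    and pos: "AE t in \<mu>. (0::real) \<le> t" "AE t in \<nu>. 0 \<le> t"
  shows "(\<integral>\<^sup>+t. ennreal t \<partial>(\<mu> \<star> \<nu>)) =
    (\<integral>\<^sup>+t. ennreal t \<partial>\<mu>) * emeasure \<nu> UNIV + emeasure \<mu> UNIV * (\<integral>\<^sup>+t. ennreal t \<partial>\<nu>)"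
proof -
  have sp: "space \<mu> = UNIV" "space \<nu> = UNIV"
    by (simp_all add: sets_eq_imp_space_eq[of _ borel])
  have "(\<integral>\<^sup>+t. ennreal t \<partial>(\<mu> \<star> \<nu>)) = (\<integral>\<^sup>+x. \<integral>\<^sup>+y. ennreal (x + y) \<partial>\<nu> \<partial>\<mu>)"
    by (intro nn_integral_convolution fin) auto
  also have "\<dots> = (\<integral>\<^sup>+x. \<integral>\<^sup>+y. ennreal x + ennreal y \<partial>\<nu> \<partial>\<mu>)"
  proof (rule nn_integral_cong_AE)
    show "AE x in \<mu>. (\<integral>\<^sup>+y. ennreal (x + y) \<partial>\<nu>) = (\<integral>\<^sup>+y. ennreal x + ennreal y \<partial>\<nu>)"
      using pos(1)
    proof eventually_elim
      case (elim x)
      show ?case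
        by (rule nn_integral_cong_AE) (use pos(2) elim in \<open>auto simp: ennreal_plus\<close>)
    qed
  qed
  also have "\<dots> = (\<integral>\<^sup>+x. ennreal x * emeasure \<nu> UNIV + (\<integral>\<^sup>+y. ennreal y \<partial>\<nu>) \<partial>\<mu>)"
    by (simp add: nn_integral_add sp)
  also have "\<dots> = (\<integral>\<^sup>+t. ennreal t \<partial>\<mu>) * emeasure \<nu> UNIV
      + emeasure \<mu> UNIV * (\<integral>\<^sup>+t. ennreal t \<partial>\<nu>)"
    by (subst nn_integral_add) (auto simp: nn_integral_multc sp mult.commute)
  finally show ?thesis .
qed

lemma emeasure_convolution_UNIV:
  assumes "finite_measure \<mu>" "finite_measure \<nu>"
    and [simp]: "sets \<mu> = sets borel" "sets \<nu> = sets borel"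
  shows "emeasure (\<mu> \<star> \<nu>) UNIV = emeasure \<mu> UNIV * emeasure \<nu> (UNIV :: real set)"
proof -
  have sp: "space \<mu> = UNIV" "space \<nu> = UNIV"
    by (simp_all add: sets_eq_imp_space_eq[of _ borel])
  show ?thesis
    using assms by (subst convolution_emeasure') (auto simp: sp mult.commute)
qed

lemma AE_nonneg_convolution:
  assumes fin: "finite_measure \<mu>" "finite_measure \<nu>"
    and [simp, measurable_cong]: "sets \<mu> = sets borel" "sets \<nu> = sets borel"
    and pos: "AE t in \<mu>. (0::real) \<le> t" "AE t in \<nu>. 0 \<le> t"
  shows "AE t in \<mu> \<star> \<nu>. 0 \<le> t"
proof (rule AE_I)
  show "{x \<in> space (\<mu> \<star> \<nu>). \<not> 0 \<le> x} \<subseteq> {..<0}" by auto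
  have "(AE x in \<mu>. (\<integral>\<^sup>+y. indicator {..<0} (x + y) \<partial>\<nu>) = 0)"
    using pos(1)
  proof eventually_elim
    case (elim x)
    have "(\<integral>\<^sup>+y. indicator {..<0} (x + y) \<partial>\<nu>) = (\<integral>\<^sup>+y. 0 \<partial>\<nu>)"
      by (rule nn_integral_cong_AE) (use pos(2) elim in \<open>auto simp: indicator_def\<close>)
    then show ?case by simp
  qed
  then have "(\<integral>\<^sup>+x. \<integral>\<^sup>+y. indicator {..<0} (x + y) \<partial>\<nu> \<partial>\<mu>) = (\<integral>\<^sup>+x. 0 \<partial>\<mu>)"
    by (rule nn_integral_cong_AE)
  then show "emeasure (\<mu> \<star> \<nu>) {..<0} = 0"
    using fin by (simp add: convolution_emeasure')
qed auto

text \<open>Covers finite \<open>A\<close> too: each of the \<open>k\<close> removed least elements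
  lies below \<open>r\<close>. This lets \<open>reduction_index\<close> be read off even on paths
  that leave the removed state only finitely often.\<close>

lemma enumerate_eqI:
  fixes A :: "nat set"
  assumes "r \<in> A" "card {l. l < r \<and> l \<in> A} = k"
  shows "enumerate A k = r"
  using assms
proof (induction k arbitrary: A)
  case 0
  then have "{l. l < r \<and> l \<in> A} = {}"
    by (simp add: card_eq_0_iff)
  then show ?case
    using 0(1) by (auto simp: enumerate_0 not_less intro!: Least_equality)
next
  case (Suc k)
  define a where "a = (LEAST l. l \<in> A)"
  obtain l where l: "l < r" "l \<in> A"
    using Suc(3) by (metis (no_types, lifting) card.empty empty_Collect_eq nat.distinct(1))
  then have a: "a \<in> A" "a < r"
    unfolding a_def by (auto intro: LeastI Least_le le_less_trans)
  have "{l. l < r \<and> l \<in> A - {a}} = {l. l < r \<and> l \<in> A} - {a}" by auto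
  then have "card {l. l < r \<and> l \<in> A - {a}} = k"
    using Suc(3) a by simp
  then have "enumerate (A - {a}) k = r"
    using Suc(2) a by (intro Suc.IH) auto
  then show ?case
    by (simp add: enumerate_Suc a_def)
qed

lemma card_less_enumerate:
  fixes A :: "nat set"
  assumes "infinite A"
  shows "card {l. l < enumerate A k \<and> l \<in> A} = k"
proof -
  have "{l. l < enumerate A k \<and> l \<in> A} = enumerate A ` {..<k}"
    using assms by (auto simp: enumerate_in_set dest: enumerate_Ex)
      (metis enumerate_Ex enumerate_mono_iff imageI lessThan_iff)
  then show ?thesis
    using inj_enumerate[OF assms] by (simp add: card_image inj_on_subset)
qed

text \<open>Deleting the least element turns one measurable family of predicates into another, so
  the induction runs over all families \<open>P\<close> at once.\<close>

lemma measurable_enumerate: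
  fixes P :: "nat \<Rightarrow> 'w \<Rightarrow> bool"
  assumes [measurable]: "\<And>i. Measurable.pred M (P i)"
  shows "(\<lambda>x. enumerate {i. P i x} k) \<in> measurable M (count_space UNIV)"
  using assms
proof (induction k arbitrary: P)
  case 0
  note [measurable] = 0
  show ?case unfolding enumerate_0 by simp
next
  case (Suc k)
  note [measurable] = Suc.prems
  have "(\<lambda>x. enumerate {i. P i x} (Suc k)) = (\<lambda>x. enumerate {i. P i x \<and> i \<noteq> (LEAST i. P i x)} k)"
    by (auto simp: enumerate_Suc intro!: ext arg_cong[where f="\<lambda>A. enumerate A k"])
  also have "\<dots> \<in> measurable M (count_space UNIV)"
    by (rule Suc.IH) measurable
  finally show ?case .
qed

subsection \<open>Semi-Markov kernels and the Markov renewal property\<close>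

lemma finite_measure_eqI_atMost:
  assumes "finite_measure \<mu>" "finite_measure \<nu>" "sets \<mu> = sets borel" "sets \<nu> = sets borel"
    and "\<And>t. measure \<mu> {..t::real} = measure \<nu> {..t}"
  shows "\<mu> = \<nu>"
  using assms
  by (intro cdf_unique') (auto simp: finite_borel_measure_def finite_borel_measure_axioms_def cdf_def)

text \<open>Separated from the process so that the kernel facts apply to
  \<open>reduced_kernel\<close> before the censored process is known to be a Markov renewal
  process.\<close>

locale semi_markov =
  fixes S :: "'s set" and Q :: "'s \<Rightarrow> 's \<Rightarrow> real \<Rightarrow> real"
  assumes finite_S: "finite S" and semi_markov_kernel: "semi_markov_kernel S Q"
begin

lemma kernel_mono: "i \<in> S \<Longrightarrow> j \<in> S \<Longrightarrow> s \<le> t \<Longrightarrow> Q i j s \<le> Q i j t"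
  using semi_markov_kernel by (auto simp: semi_markov_kernel_def mono_def)

lemma kernel_right_cont: "i \<in> S \<Longrightarrow> j \<in> S \<Longrightarrow> continuous (at_right t) (Q i j)"
  using semi_markov_kernel by (auto simp: semi_markov_kernel_def)

lemma kernel_neg: "i \<in> S \<Longrightarrow> j \<in> S \<Longrightarrow> t < 0 \<Longrightarrow> Q i j t = 0"
  using semi_markov_kernel by (auto simp: semi_markov_kernel_def)

lemma kernel_nonneg: "i \<in> S \<Longrightarrow> j \<in> S \<Longrightarrow> 0 \<le> Q i j t"
  using kernel_mono[of i j "min t (-1)" t] kernel_neg[of i j "min t (-1)"] by auto

lemma kernel_sum_tendsto: "i \<in> S \<Longrightarrow> ((\<lambda>t. \<Sum>j\<in>S. Q i j t) \<longlongrightarrow> 1) at_top"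
  using semi_markov_kernel by (auto simp: semi_markov_kernel_def)

lemma kernel_le_1:
  assumes "i \<in> S" "j \<in> S"
  shows "Q i j t \<le> 1"
proof -
  have "Q i j t \<le> (\<Sum>j\<in>S. Q i j t)"
    using assms finite_S kernel_nonneg by (intro member_le_sum) auto
  also have "\<dots> \<le> 1"
    by (rule tendsto_lowerbound[OF kernel_sum_tendsto[OF assms(1)]])
      (auto intro!: sum_mono kernel_mono assms(1) exI[of _ t] simp: eventually_at_top_linorder)
  finally show ?thesis .
qed

text \<open>\<open>transition_prob\<close> is defined through \<open>Lim\<close>, which carries no
  information until convergence is known; monotonicity and the bound 1 supply it.\<close>

lemma kernel_tendsto:
  assumes "i \<in> S" "j \<in> S"
  shows "(Q i j \<longlongrightarrow> transition_prob Q i j) at_top"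
proof -
  have mono: "mono (Q i j)"
    using assms kernel_mono by (auto simp: mono_def)
  then have "incseq (\<lambda>n. Q i j (real n))"
    by (auto simp: incseq_def mono_def)
  moreover have "\<forall>n. Q i j (real n) \<le> 1"
    using kernel_le_1[OF assms] by auto
  ultimately obtain L where "(\<lambda>n. Q i j (real n)) \<longlonglongrightarrow> L"
    by (rule incseq_convergent)
  then have "(Q i j \<longlongrightarrow> L) at_top"
    by (rule tendsto_at_topI_sequentially_real[OF mono])
  then show ?thesis
    unfolding transition_prob_def using tendsto_Lim by (metis trivial_limit_at_top_linorder)
qed

lemma transition_prob_nonneg: "i \<in> S \<Longrightarrow> j \<in> S \<Longrightarrow> 0 \<le> transition_prob Q i j"
  by (rule tendsto_lowerbound[OF kernel_tendsto]) (auto simp: kernel_nonneg)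

lemma transition_prob_sum:
  assumes "i \<in> S"
  shows "(\<Sum>j\<in>S. transition_prob Q i j) = 1"
  by (rule tendsto_unique[OF _ tendsto_sum kernel_sum_tendsto[OF assms]])
    (auto intro!: kernel_tendsto assms)

lemma transition_prob_le_1: "i \<in> S \<Longrightarrow> j \<in> S \<Longrightarrow> transition_prob Q i j \<le> 1"
  by (rule tendsto_upperbound[OF kernel_tendsto]) (auto simp: kernel_le_1)

lemma
  assumes "i \<in> S" "j \<in> S"
  shows finite_measure_step: "finite_measure (interval_measure (Q i j))"
    and emeasure_step_UNIV: "emeasure (interval_measure (Q i j)) UNIV = ennreal (transition_prob Q i j)"
    and measure_step_atMost: "measure (interval_measure (Q i j)) {..t} = Q i j t"
    and AE_step_nonneg: "AE t in interval_measure (Q i j). 0 \<le> t"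
proof -
  have bot: "(Q i j \<longlongrightarrow> 0) at_bot"
    by (rule tendsto_eventually) (use assms kernel_neg in \<open>auto simp: eventually_at_bot_dense\<close>)
  note * = kernel_mono[OF assms] kernel_right_cont[OF assms] bot kernel_tendsto[OF assms]
    transition_prob_nonneg[OF assms]
  have fb: "finite_borel_measure (interval_measure (Q i j))"
    using * by (rule finite_borel_measure_interval_measure)
  then interpret finite_borel_measure "interval_measure (Q i j)" .
  show "finite_measure (interval_measure (Q i j))"
    by (rule finite_measure_axioms)
  show "emeasure (interval_measure (Q i j)) UNIV = ennreal (transition_prob Q i j)"
    using * by (rule interval_measure_UNIV)
  have cdf: "cdf (interval_measure (Q i j)) t = Q i j t" for t
  proof -
    \<comment> \<open>\<open>interval_measure\<close> fixes only increments. The additive constant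
      is settled by sending the left endpoint to minus infinity, where both functions
      vanish.\<close>
    have "((\<lambda>s. Q i j t - Q i j s) \<longlongrightarrow> Q i j t - 0) at_bot"
      by (intro tendsto_intros bot)
    moreover have "((\<lambda>s. cdf (interval_measure (Q i j)) t - cdf (interval_measure (Q i j)) s)
        \<longlongrightarrow> cdf (interval_measure (Q i j)) t - 0) at_bot"
      by (intro tendsto_intros cdf_lim_at_bot)
    moreover have ev: "\<forall>\<^sub>F s in at_bot. Q i j t - Q i j s =
        cdf (interval_measure (Q i j)) t - cdf (interval_measure (Q i j)) s"
      unfolding eventually_at_bot_dense
      by (intro exI[of _ t] allI impI, subst cdf_diff_eq)
        (use * in \<open>auto simp: measure_interval_measure_Ioc\<close>)
    ultimately have "Q i j t - 0 = cdf (interval_measure (Q i j)) t - 0"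
      using tendsto_cong[OF ev] by (intro tendsto_unique[OF trivial_limit_at_bot_linorder]) auto
    then show ?thesis by simp
  qed
  then show "measure (interval_measure (Q i j)) {..t} = Q i j t"
    by (simp add: cdf_def)
  show "AE t in interval_measure (Q i j). 0 \<le> t"
  proof -
    \<comment> \<open>These half-lines exhaust the negative numbers, and each has mass equal to
      \<open>Q i j\<close> at a negative point, which is 0.\<close>
    have "AE x in interval_measure (Q i j). x \<notin> {..- 1 / real (Suc n)}" for n
      using cdf[of "- 1 / real (Suc n)"] kernel_neg[OF assms, of "- 1 / real (Suc n)"]
      by (intro AE_not_in) (auto simp: null_sets_def cdf_def emeasure_eq_measure)
    then have "AE x in interval_measure (Q i j). \<forall>n. x \<notin> {..- 1 / real (Suc n)}"
      by (subst AE_all_countable) blast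
    then show ?thesis
    proof eventually_elim
      case (elim x)
      show ?case
      proof (rule ccontr)
        assume "\<not> 0 \<le> x"
        then obtain n where "inverse (real (Suc n)) < - x"
          using reals_Archimedean[of "- x"] by auto
        with elim show False
          by (auto simp: divide_inverse not_le dest!: spec[of _ n])
      qed
    qed
  qed
qed

lemma mean_holding_time_eq:
  "mean_holding_time S Q i = (\<Sum>j\<in>S. \<integral>\<^sup>+t. ennreal t \<partial>interval_measure (Q i j))"
  unfolding mean_holding_time_def
  by (intro sum.cong nn_integral_cong refl) (auto simp: indicator_def ennreal_neg)

end

text \<open>One step of the chain killed on entering \<open>j\<close>, acting on functions.\<close>

definition taboo_step :: "'s set \<Rightarrow> ('s \<Rightarrow> 's \<Rightarrow> real) \<Rightarrow> 's \<Rightarrow> ('s \<Rightarrow> ennreal) \<Rightarrow> 's \<Rightarrow> ennreal" where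
  "taboo_step S p j f i = (\<Sum>l\<in>S - {j}. ennreal (p i l) * f l)"

lemma space_process_history [simp]: "space (process_history M X T k) = space M"
  unfolding process_history_def by (rule space_measure_of) auto

lemma sets_process_history:
  "sets (process_history M X T k) = sigma_sets (space M)
     ({X l -` {x} \<inter> space M |l x. l \<le> k} \<union> {T l -` B \<inter> space M |l B. l \<le> k \<and> B \<in> sets borel})"
  unfolding process_history_def by (rule sets_measure_of) auto

lemma sets_process_history_subset:
  assumes "\<And>l. X l \<in> measurable M (count_space UNIV)" "\<And>l. T l \<in> borel_measurable M"
  shows "sets (process_history M X T k) \<subseteq> sets M"
  unfolding sets_process_history
  using measurable_sets[OF assms(1)] measurable_sets[OF assms(2)]
  by (intro sets.sigma_sets_subset) auto

section \<open>Laws of steps and of passage times on history events\<close>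

context markov_renewal_process
begin

sublocale semi_markov S Q
  by unfold_locales (fact finite_state_space kernel)+

abbreviation history :: "nat \<Rightarrow> 'w measure" where
  "history k \<equiv> process_history M X T k"

lemma sets_history_subset: "sets (history k) \<subseteq> sets M"
  by (intro sets_process_history_subset X_measurable T_measurable)

lemma subalgebra_history: "subalgebra M (history k)"
  using sets_history_subset by (simp add: subalgebra_def)

lemma sets_history_mono: "k \<le> l \<Longrightarrow> sets (history k) \<subseteq> sets (history l)"
  unfolding sets_process_history
  by (intro sigma_sets_mono' Un_mono Collect_mono) (metis le_trans)+

lemma pred_history_X: "l \<le> k \<Longrightarrow> Measurable.pred (history k) (\<lambda>\<omega>. X l \<omega> = x)"
proof -
  assume "l \<le> k"
  moreover have "{\<omega> \<in> space M. X l \<omega> = x} = X l -` {x} \<inter> space M"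
    by auto
  ultimately show ?thesis
    unfolding pred_def sets_process_history space_process_history by (intro sigma_sets.Basic) blast
qed

lemma measurable_history_T: "l \<le> k \<Longrightarrow> T l \<in> borel_measurable (history k)"
  by (rule measurableI, simp, unfold sets_process_history space_process_history) (blast intro: sigma_sets.Basic)

lemma pred_X [measurable]: "Measurable.pred M (\<lambda>\<omega>. X k \<omega> = x)"
  using X_measurable[of k] by (auto intro: measurable_compose)

lemmas T_measurable [measurable]

text \<open>On \<open>A\<close> the conditional probability is the constant \<open>Q i j t\<close>,
  so integrating it over \<open>A\<close> gives the claim on half-lines \<open>{..t}\<close>. Finite
  measures on the line are determined there, which extends it to all Borel sets.\<close>

lemma step_distr:
  assumes A: "A \<in> sets (history r)" "\<And>\<omega>. \<omega> \<in> A \<Longrightarrow> X r \<omega> = i" and ij: "i \<in> S" "j \<in> S"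
  shows "distr (density M (indicator (A \<inter> {\<omega> \<in> space M. X (Suc r) \<omega> = j}))) borel (\<lambda>\<omega>. T (Suc r) \<omega> - T r \<omega>)
    = density (interval_measure (Q i j)) (\<lambda>_. emeasure M A)" (is "?L = ?R")
proof -
  interpret N: finite_measure "interval_measure (Q i j)"
    using ij by (rule finite_measure_step)
  interpret H: finite_measure_subalgebra M "history r"
    by unfold_locales (rule subalgebra_history)
  have [measurable]: "A \<in> sets M"
    using A sets_history_subset by auto
  let ?E = "A \<inter> {\<omega> \<in> space M. X (Suc r) \<omega> = j}"
  have L: "emeasure ?L B = emeasure M (?E \<inter> {\<omega> \<in> space M. T (Suc r) \<omega> - T r \<omega> \<in> B})"
    if [measurable]: "B \<in> sets borel" for B
  proof -
    have "emeasure ?L B = (\<integral>\<^sup>+\<omega>. indicator ?E \<omega> * indicator ((\<lambda>\<omega>. T (Suc r) \<omega> - T r \<omega>) -` B \<inter> space M) \<omega> \<partial>M)"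
      by (subst emeasure_distr) (auto simp: emeasure_density)
    also have "\<dots> = (\<integral>\<^sup>+\<omega>. indicator (?E \<inter> {\<omega> \<in> space M. T (Suc r) \<omega> - T r \<omega> \<in> B}) \<omega> \<partial>M)"
      by (intro nn_integral_cong) (auto simp: indicator_def)
    finally show ?thesis by simp
  qed
  have R: "emeasure ?R B = emeasure M A * emeasure (interval_measure (Q i j)) B" if "B \<in> sets borel" for B
    using that by (simp add: emeasure_density_const)
  show ?thesis
  proof (rule finite_measure_eqI_atMost)
    show "finite_measure ?L"
      by (rule finite_measureI) (simp add: L space_distr del: emeasure_distr)
    show "finite_measure ?R"
    proof (rule finite_measureI)
      have "emeasure ?R UNIV \<noteq> \<infinity>"
        using R[of UNIV] N.emeasure_finite[of UNIV] emeasure_finite[of A]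
        by (simp add: ennreal_mult_eq_top_iff)
      then show "emeasure ?R (space ?R) \<noteq> \<infinity>" by simp
    qed
    fix t
    let ?G = "{\<omega> \<in> space M. X (Suc r) \<omega> = j \<and> T (Suc r) \<omega> - T r \<omega> \<le> t}"
    have "measure ?L {..t} = measure M (A \<inter> ?G)"
      by (auto simp: measure_def L intro!: arg_cong[where f="\<lambda>A. enn2real (emeasure M A)"])
    also have "\<dots> = (\<integral>\<omega>\<in>A. indicator ?G \<omega> \<partial>M)"
      by (simp add: set_lebesgue_integral_def flip: indicator_inter_arith)
    also have "\<dots> = (\<integral>\<omega>\<in>A. real_cond_exp M (history r) (indicator ?G) \<omega> \<partial>M)"
      by (rule H.real_cond_exp_intA) (use A in \<open>auto simp: emeasure_eq_measure\<close>)
    also have "\<dots> = (\<integral>\<omega>\<in>A. Q i j t \<partial>M)"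
    proof -
      have "AE \<omega> in M. indicator A \<omega> *\<^sub>R real_cond_exp M (history r) (indicator ?G) \<omega> = indicator A \<omega> *\<^sub>R Q i j t"
        using markov_renewal_property[OF ij(2), of r t]
        by eventually_elim (auto simp: indicator_def A(2))
      then show ?thesis
        unfolding set_lebesgue_integral_def by (intro integral_cong_AE) auto
    qed
    also have "\<dots> = measure M A * Q i j t"
      by (simp add: set_lebesgue_integral_def)
    also have "\<dots> = measure ?R {..t}"
      using measure_step_atMost[OF ij, of t]
      by (simp add: measure_def R enn2real_mult)
    finally show "measure ?L {..t} = measure ?R {..t}" .
  qed auto
qed

lemma step_nn_integral:
  assumes A: "A \<in> sets (history r)" "\<And>\<omega>. \<omega> \<in> A \<Longrightarrow> X r \<omega> = i" and ij: "i \<in> S" "j \<in> S"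
    and [measurable]: "g \<in> borel_measurable borel"
  shows "(\<integral>\<^sup>+\<omega>. indicator (A \<inter> {\<omega> \<in> space M. X (Suc r) \<omega> = j}) \<omega> * g (T (Suc r) \<omega> - T r \<omega>) \<partial>M)
    = emeasure M A * (\<integral>\<^sup>+t. g t \<partial>interval_measure (Q i j))"
proof -
  have [measurable]: "A \<in> sets M"
    using A sets_history_subset by auto
  have "(\<integral>\<^sup>+\<omega>. indicator (A \<inter> {\<omega> \<in> space M. X (Suc r) \<omega> = j}) \<omega> * g (T (Suc r) \<omega> - T r \<omega>) \<partial>M)
     = (\<integral>\<^sup>+t. g t \<partial>distr (density M (indicator (A \<inter> {\<omega> \<in> space M. X (Suc r) \<omega> = j}))) borel
         (\<lambda>\<omega>. T (Suc r) \<omega> - T r \<omega>))"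
    by (subst nn_integral_distr) (auto simp: nn_integral_density)
  also have "\<dots> = (\<integral>\<^sup>+t. g t \<partial>density (interval_measure (Q i j)) (\<lambda>_. emeasure M A))"
    using step_distr[OF A ij] by simp
  finally show ?thesis
    by (simp add: nn_integral_density nn_integral_cmult)
qed

lemma step_emeasure:
  assumes A: "A \<in> sets (history r)" "\<And>\<omega>. \<omega> \<in> A \<Longrightarrow> X r \<omega> = i" and ij: "i \<in> S" "j \<in> S"
    and [measurable]: "B \<in> sets borel"
  shows "emeasure M (A \<inter> {\<omega> \<in> space M. X (Suc r) \<omega> = j \<and> T (Suc r) \<omega> - T r \<omega> \<in> B})
    = emeasure M A * emeasure (interval_measure (Q i j)) B"
proof -
  have [measurable]: "A \<in> sets M"
    using A sets_history_subset by auto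
  have "emeasure M (A \<inter> {\<omega> \<in> space M. X (Suc r) \<omega> = j \<and> T (Suc r) \<omega> - T r \<omega> \<in> B})
      = (\<integral>\<^sup>+\<omega>. indicator (A \<inter> {\<omega> \<in> space M. X (Suc r) \<omega> = j \<and> T (Suc r) \<omega> - T r \<omega> \<in> B}) \<omega> \<partial>M)"
    by (rule nn_integral_indicator[symmetric]) measurable
  also have "\<dots> = (\<integral>\<^sup>+\<omega>. indicator (A \<inter> {\<omega> \<in> space M. X (Suc r) \<omega> = j}) \<omega> * indicator B (T (Suc r) \<omega> - T r \<omega>) \<partial>M)"
    by (intro nn_integral_cong) (auto simp: indicator_def)
  also have "\<dots> = emeasure M A * (\<integral>\<^sup>+t. indicator B t \<partial>interval_measure (Q i j))"
    by (rule step_nn_integral[OF A ij]) auto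
  finally show ?thesis
    by simp
qed

lemma step_emeasure_state:
  assumes A: "A \<in> sets (history r)" "\<And>\<omega>. \<omega> \<in> A \<Longrightarrow> X r \<omega> = i" and ij: "i \<in> S" "j \<in> S"
  shows "emeasure M (A \<inter> {\<omega> \<in> space M. X (Suc r) \<omega> = j}) = emeasure M A * ennreal (transition_prob Q i j)"
  using step_emeasure[OF A ij, of UNIV] ij by (simp add: emeasure_step_UNIV)

lemma nn_integral_split_state:
  assumes [measurable]: "f \<in> borel_measurable M"
  shows "(\<integral>\<^sup>+\<omega>. f \<omega> \<partial>M) = (\<Sum>l\<in>S. \<integral>\<^sup>+\<omega>. indicator {\<omega> \<in> space M. X k \<omega> = l} \<omega> * f \<omega> \<partial>M)"
proof -
  have "(\<integral>\<^sup>+\<omega>. f \<omega> \<partial>M) = (\<integral>\<^sup>+\<omega>. (\<Sum>l\<in>S. indicator {\<omega> \<in> space M. X k \<omega> = l} \<omega> * f \<omega>) \<partial>M)"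
  proof (intro nn_integral_cong_AE)
    show "AE \<omega> in M. f \<omega> = (\<Sum>l\<in>S. indicator {\<omega> \<in> space M. X k \<omega> = l} \<omega> * f \<omega>)"
      using X_in_S[of k] AE_space
    proof eventually_elim
      case (elim \<omega>)
      have "(\<Sum>l\<in>S. indicator {\<omega> \<in> space M. X k \<omega> = l} \<omega> * f \<omega>) = (\<Sum>l\<in>S. if X k \<omega> = l then f \<omega> else 0)"
        using elim by (intro sum.cong) (auto simp: indicator_def)
      then show ?case
        using elim finite_S by simp
    qed
  qed
  also have "\<dots> = (\<Sum>l\<in>S. \<integral>\<^sup>+\<omega>. indicator {\<omega> \<in> space M. X k \<omega> = l} \<omega> * f \<omega> \<partial>M)"
    by (rule nn_integral_sum) measurable
  finally show ?thesis .
qed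

lemma step_mean_holding_time:
  assumes A: "A \<in> sets (history r)" "\<And>\<omega>. \<omega> \<in> A \<Longrightarrow> X r \<omega> = i" and i: "i \<in> S"
  shows "(\<integral>\<^sup>+\<omega>. indicator A \<omega> * ennreal (T (Suc r) \<omega> - T r \<omega>) \<partial>M) = emeasure M A * mean_holding_time S Q i"
proof -
  have [measurable]: "A \<in> sets M"
    using A sets_history_subset by auto
  have "(\<integral>\<^sup>+\<omega>. indicator A \<omega> * ennreal (T (Suc r) \<omega> - T r \<omega>) \<partial>M) =
    (\<Sum>l\<in>S. \<integral>\<^sup>+\<omega>. indicator {\<omega> \<in> space M. X (Suc r) \<omega> = l} \<omega> * (indicator A \<omega> * ennreal (T (Suc r) \<omega> - T r \<omega>)) \<partial>M)"
    by (rule nn_integral_split_state) measurable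
  also have "\<dots> = (\<Sum>l\<in>S. emeasure M A * (\<integral>\<^sup>+t. ennreal t \<partial>interval_measure (Q i l)))"
    by (intro sum.cong refl, subst step_nn_integral[OF A i, symmetric])
      (auto intro!: nn_integral_cong simp: indicator_def)
  also have "\<dots> = emeasure M A * mean_holding_time S Q i"
    by (simp add: mean_holding_time_eq sum_distrib_left)
  finally show ?thesis .
qed

text \<open>The first step is peeled off and absorbed into the conditioning event, which moves from
  \<open>history r\<close> to \<open>history (Suc r)\<close>; hence \<open>r\<close>,
  \<open>A\<close> and \<open>i\<close> vary in the induction. \<open>Y\<close> is kept abstract to
  serve both for probabilities (\<open>Y\<close> constantly 1) and for holding times.\<close>

lemma taboo_nn_integral:
  fixes Y :: "nat \<Rightarrow> 'w \<Rightarrow> ennreal"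
  assumes Y_meas [measurable]: "\<And>r. Y r \<in> borel_measurable M"
    and Y: "\<And>r A i. A \<in> sets (history r) \<Longrightarrow> (\<And>\<omega>. \<omega> \<in> A \<Longrightarrow> X r \<omega> = i) \<Longrightarrow> i \<in> S \<Longrightarrow>
      (\<integral>\<^sup>+\<omega>. indicator A \<omega> * Y r \<omega> \<partial>M) = emeasure M A * f i"
    and A: "A \<in> sets (history r)" "\<And>\<omega>. \<omega> \<in> A \<Longrightarrow> X r \<omega> = i" and i: "i \<in> S"
  shows "(\<integral>\<^sup>+\<omega>. indicator (A \<inter> {\<omega> \<in> space M. \<forall>q\<in>{r<..r+k}. X q \<omega> \<noteq> j}) \<omega> * Y (r + k) \<omega> \<partial>M)
    = emeasure M A * (taboo_step S (transition_prob Q) j ^^ k) f i"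
  using A i
proof (induction k arbitrary: r A i)
  case 0
  have "A \<inter> space M = A"
    using 0(1) sets.sets_into_space by fastforce
  then show ?case
    using Y[OF 0] by simp
next
  case (Suc k)
  have [measurable]: "A \<in> sets M"
    using Suc.prems(1) sets_history_subset by blast
  define A' where "A' l = A \<inter> {\<omega> \<in> space M. X (Suc r) \<omega> = l}" for l
  have A': "A' l \<in> sets (history (Suc r))" for l
    unfolding A'_def using pred_history_X[of "Suc r" "Suc r" l] sets_history_mono[of r "Suc r"] Suc(2)
    by (auto simp: pred_def)
  have split: "{r<..r + Suc k} = insert (Suc r) {Suc r<..Suc r + k}"
    by auto
  let ?v = "(taboo_step S (transition_prob Q) j ^^ k) f"
  let ?g = "\<lambda>\<omega>. indicator (A \<inter> {\<omega> \<in> space M. \<forall>q\<in>{r<..r+Suc k}. X q \<omega> \<noteq> j}) \<omega> * Y (r + Suc k) \<omega>"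
  have "(\<integral>\<^sup>+\<omega>. ?g \<omega> \<partial>M) = (\<Sum>l\<in>S. \<integral>\<^sup>+\<omega>. indicator {\<omega> \<in> space M. X (Suc r) \<omega> = l} \<omega> * ?g \<omega> \<partial>M)"
    by (rule nn_integral_split_state) measurable
  also have "\<dots> = (\<Sum>l\<in>S. if l \<noteq> j then emeasure M A * (ennreal (transition_prob Q i l) * ?v l) else 0)"
  proof (intro sum.cong refl)
    fix l assume l: "l \<in> S"
    show "(\<integral>\<^sup>+\<omega>. indicator {\<omega> \<in> space M. X (Suc r) \<omega> = l} \<omega> * ?g \<omega> \<partial>M) =
      (if l \<noteq> j then emeasure M A * (ennreal (transition_prob Q i l) * ?v l) else 0)"
    proof (cases "l = j")
      case True
      then have "(\<integral>\<^sup>+\<omega>. indicator {\<omega> \<in> space M. X (Suc r) \<omega> = l} \<omega> * ?g \<omega> \<partial>M) = (\<integral>\<^sup>+\<omega>. 0 \<partial>M)"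
        by (intro nn_integral_cong) (auto simp: indicator_def)
      with True show ?thesis by simp
    next
      case False
      then have "(\<integral>\<^sup>+\<omega>. indicator {\<omega> \<in> space M. X (Suc r) \<omega> = l} \<omega> * ?g \<omega> \<partial>M) =
        (\<integral>\<^sup>+\<omega>. indicator (A' l \<inter> {\<omega> \<in> space M. \<forall>q\<in>{Suc r<..Suc r+k}. X q \<omega> \<noteq> j}) \<omega> * Y (Suc r + k) \<omega> \<partial>M)"
        unfolding split by (intro nn_integral_cong) (auto simp: A'_def indicator_def)
      also have "\<dots> = emeasure M (A' l) * ?v l"
        by (rule Suc.IH[OF A' _ l]) (auto simp: A'_def)
      also have "emeasure M (A' l) = emeasure M A * ennreal (transition_prob Q i l)"
        unfolding A'_def by (rule step_emeasure_state) (use Suc l in auto)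
      finally show ?thesis
        using False by (simp add: mult.assoc)
    qed
  qed
  also have "\<dots> = (\<Sum>l\<in>S - {j}. emeasure M A * (ennreal (transition_prob Q i l) * ?v l))"
    using finite_S by (intro sum.mono_neutral_cong_right) auto
  also have "\<dots> = emeasure M A * (taboo_step S (transition_prob Q) j ^^ Suc k) f i"
    by (simp add: taboo_step_def sum_distrib_left)
  finally show ?case .
qed

lemma emeasure_avoid:
  assumes A: "A \<in> sets (history r)" "\<And>\<omega>. \<omega> \<in> A \<Longrightarrow> X r \<omega> = i" and i: "i \<in> S"
  shows "emeasure M (A \<inter> {\<omega> \<in> space M. \<forall>q\<in>{r<..r+k}. X q \<omega> \<noteq> j})
    = emeasure M A * (taboo_step S (transition_prob Q) j ^^ k) (\<lambda>_. 1) i"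
proof -
  have [measurable]: "A \<in> sets M"
    using A sets_history_subset by auto
  show ?thesis
    by (subst taboo_nn_integral[OF _ _ A i, where Y="\<lambda>_ _. 1", symmetric])
      (use sets_history_subset in \<open>auto simp: subset_iff\<close>)
qed

text \<open>Telescoping: the interval after step \<open>k\<close> counts exactly when
  \<open>k\<close> lies before the passage index, and this can be decided from steps 1 to
  \<open>k\<close>. Step 0 is not tested, so a start in \<open>j\<close> yields the recurrence
  time.\<close>

lemma first_passage_time_eq_suminf:
  assumes mono: "\<And>k. T k \<omega> \<le> T (Suc k) \<omega>" and ex: "\<exists>k\<ge>1. X k \<omega> = j"
  shows "first_passage_time X T j \<omega> =
    (\<Sum>k. if \<forall>q\<in>{0<..k}. X q \<omega> \<noteq> j then ennreal (T (Suc k) \<omega> - T k \<omega>) else 0)"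
proof -
  define \<kappa> where "\<kappa> = (LEAST k. k \<ge> 1 \<and> X k \<omega> = j)"
  have \<kappa>: "\<kappa> \<ge> 1" "X \<kappa> \<omega> = j"
    using LeastI_ex[of "\<lambda>k. k \<ge> 1 \<and> X k \<omega> = j"] ex by (auto simp: \<kappa>_def)
  have before: "X k \<omega> \<noteq> j" if "1 \<le> k" "k < \<kappa>" for k
    using not_less_Least[of k "\<lambda>k. k \<ge> 1 \<and> X k \<omega> = j"] that by (auto simp: \<kappa>_def)
  have cond: "(\<forall>q\<in>{0<..k}. X q \<omega> \<noteq> j) \<longleftrightarrow> k < \<kappa>" for k
  proof
    assume avoid: "\<forall>q\<in>{0<..k}. X q \<omega> \<noteq> j"
    show "k < \<kappa>"
    proof (rule ccontr)
      assume "\<not> k < \<kappa>"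
      then have "\<kappa> \<in> {0<..k}" using \<kappa>(1) by simp
      with avoid \<kappa>(2) show False by blast
    qed
  next
    assume "k < \<kappa>"
    show "\<forall>q\<in>{0<..k}. X q \<omega> \<noteq> j"
    proof
      fix q assume "q \<in> {0<..k}"
      with \<open>k < \<kappa>\<close> show "X q \<omega> \<noteq> j" by (intro before) auto
    qed
  qed
  have T_le: "T 0 \<omega> \<le> T k \<omega>" for k
    by (induction k) (auto intro: order_trans mono)
  have "(\<Sum>k. if \<forall>q\<in>{0<..k}. X q \<omega> \<noteq> j then ennreal (T (Suc k) \<omega> - T k \<omega>) else 0)
     = (\<Sum>k<\<kappa>. if \<forall>q\<in>{0<..k}. X q \<omega> \<noteq> j then ennreal (T (Suc k) \<omega> - T k \<omega>) else 0)"
    unfolding cond by (intro suminf_finite) auto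
  also have "\<dots> = (\<Sum>k<\<kappa>. ennreal (T (Suc k) \<omega> - T k \<omega>))"
    unfolding cond by (intro sum.cong) auto
  also have "\<dots> = ennreal (\<Sum>k<\<kappa>. T (Suc k) \<omega> - T k \<omega>)"
    using mono by (intro sum_ennreal) auto
  also have "\<dots> = ennreal (T \<kappa> \<omega> - T 0 \<omega>)"
    using sum_lessThan_telescope[of "\<lambda>k. T k \<omega>" \<kappa>] by (simp only:)
  finally show ?thesis
    using ex by (simp add: first_passage_time_def \<kappa>_def)
qed

text \<open>The role of \<open>hit\<close>: on a path that misses \<open>j\<close> the passage time
  is infinite by definition, while its series of holding times may converge.\<close>

lemma mean_first_passage_time_eq_suminf:
  assumes i: "i \<in> S" and pos: "measure M {\<omega> \<in> space M. X 0 \<omega> = i} > 0"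
    and hit: "AE \<omega> in M. \<exists>k\<ge>1. X k \<omega> = j"
  shows "mean_first_passage_time M X T i j =
    (\<Sum>k. (taboo_step S (transition_prob Q) j ^^ k) (mean_holding_time S Q) i)"
proof -
  define A where "A = {\<omega> \<in> space M. X 0 \<omega> = i}"
  have A: "A \<in> sets (history 0)"
    using pred_history_X[of 0 0 i] by (simp add: A_def pred_def)
  have [measurable]: "A \<in> sets M"
    by (simp add: A_def)
  \<comment> \<open>Written with \<open>0 + k\<close> to match \<open>taboo_nn_integral\<close> at
    \<open>r = 0\<close>.\<close>
  define D where "D k \<omega> = indicator (A \<inter> {\<omega> \<in> space M. \<forall>q\<in>{0<..0+k}. X q \<omega> \<noteq> j}) \<omega> * ennreal (T (Suc (0+k)) \<omega> - T (0+k) \<omega>)"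
    for k \<omega>
  have D_meas [measurable]: "D k \<in> borel_measurable M" for k
    unfolding D_def by measurable
  let ?v = "\<lambda>k. (taboo_step S (transition_prob Q) j ^^ k) (mean_holding_time S Q)"
  have D: "(\<integral>\<^sup>+\<omega>. D k \<omega> \<partial>M) = emeasure M A * ?v k i" for k
    unfolding D_def
    by (rule taboo_nn_integral[where Y="\<lambda>r \<omega>. ennreal (T (Suc r) \<omega> - T r \<omega>)"])
      (use A i in \<open>auto simp: A_def intro: step_mean_holding_time\<close>)
  have "AE \<omega> in M. \<forall>k. T k \<omega> \<le> T (Suc k) \<omega>"
    using T_mono by (simp add: AE_all_countable)
  then have AE_eq: "AE \<omega> in M. first_passage_time X T j \<omega> * indicator A \<omega> = (\<Sum>k. D k \<omega>)"
    using hit AE_space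
  proof eventually_elim
    case (elim \<omega>)
    then have "first_passage_time X T j \<omega> =
      (\<Sum>k. if \<forall>q\<in>{0<..k}. X q \<omega> \<noteq> j then ennreal (T (Suc k) \<omega> - T k \<omega>) else 0)"
      by (intro first_passage_time_eq_suminf) auto
    moreover have "D k \<omega> = (if \<forall>q\<in>{0<..k}. X q \<omega> \<noteq> j then ennreal (T (Suc k) \<omega> - T k \<omega>) else 0) * indicator A \<omega>" for k
      using elim by (auto simp: D_def indicator_def)
    ultimately show ?case
      by simp
  qed
  let ?AM = "uniform_measure M A"
  have "mean_first_passage_time M X T i j = (\<integral>\<^sup>+\<omega>. first_passage_time X T j \<omega> \<partial>?AM)"
    by (simp add: mean_first_passage_time_def A_def)
  also have "\<dots> = (\<integral>\<^sup>+\<omega>. (\<Sum>k. D k \<omega>) \<partial>?AM)"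
  proof (rule nn_integral_cong_AE, rule AE_uniform_measureI)
    show "AE \<omega> in M. \<omega> \<in> A \<longrightarrow> first_passage_time X T j \<omega> = (\<Sum>k. D k \<omega>)"
      using AE_eq by eventually_elim auto
  qed simp
  also have "\<dots> = (\<integral>\<^sup>+\<omega>. (\<Sum>k. D k \<omega>) * indicator A \<omega> \<partial>M) / emeasure M A"
    by (rule nn_integral_uniform_measure) auto
  also have "(\<integral>\<^sup>+\<omega>. (\<Sum>k. D k \<omega>) * indicator A \<omega> \<partial>M) = (\<integral>\<^sup>+\<omega>. (\<Sum>k. D k \<omega>) \<partial>M)"
    by (intro nn_integral_cong) (auto simp: D_def indicator_def)
  also have "\<dots> = emeasure M A * (\<Sum>k. ?v k i)"
    by (simp add: nn_integral_suminf D)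
  also have "\<dots> / emeasure M A = (\<Sum>k. ?v k i)"
    using pos by (subst mult.commute, intro mult_divide_eq_ennreal) (auto simp: A_def emeasure_eq_measure)
  finally show ?thesis .
qed

end

subsection \<open>Taboo probabilities and recurrence\<close>

lemma ennreal_add_less_le_mono:
  fixes a b c d :: ennreal
  assumes "a < b" "c \<le> d" "d < \<infinity>"
  shows "a + c < b + d"
proof -
  have "a + c \<le> d + a"
    using assms(2) by (metis add.commute add_left_mono)
  also have "\<dots> < d + b"
    using assms by (subst ennreal_add_left_cancel_less) auto
  finally show ?thesis
    by (simp only: add.commute)
qed

lemma taboo_step_mono: "(\<And>l. l \<in> S \<Longrightarrow> f l \<le> g l) \<Longrightarrow> taboo_step S p j f i \<le> taboo_step S p j g i"
  unfolding taboo_step_def by (intro sum_mono mult_left_mono) auto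

lemma taboo_step_cong: "(\<And>l. l \<in> S \<Longrightarrow> f l = g l) \<Longrightarrow> taboo_step S p j f i = taboo_step S p j g i"
  unfolding taboo_step_def by (intro sum.cong) auto

lemma taboo_step_sum: "taboo_step S p j (\<lambda>l. \<Sum>k\<in>K. f k l) i = (\<Sum>k\<in>K. taboo_step S p j (f k) i)"
  unfolding taboo_step_def by (simp add: sum_distrib_left sum.swap[of _ K])

lemma taboo_step_cmult: "taboo_step S p j (\<lambda>l. c * f l) i = c * taboo_step S p j f i"
  unfolding taboo_step_def by (simp add: sum_distrib_left mult.left_commute)

lemma taboo_step_suminf: "taboo_step S p j (\<lambda>l. \<Sum>k. f k l) i = (\<Sum>k. taboo_step S p j (f k) i)"
  unfolding taboo_step_def by (subst suminf_sum) (auto intro: summableI)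

lemma taboo_suminf_unfold:
  "(\<Sum>k. (taboo_step S p j ^^ k) f i) = f i + taboo_step S p j (\<lambda>l. \<Sum>k. (taboo_step S p j ^^ k) f l) i"
  by (subst ennreal_suminf_split_head) (simp add: taboo_step_suminf)

text \<open>A supersolution dominates every partial sum, since applying the step to a dominated
  partial sum and adding \<open>f\<close> gives the next one. The inequality form serves both to
  prove finiteness and to compare two systems.\<close>

lemma taboo_suminf_le:
  assumes "\<And>l. l \<in> S \<Longrightarrow> f l + taboo_step S p j x l \<le> x l" and "i \<in> S"
  shows "(\<Sum>k. (taboo_step S p j ^^ k) f i) \<le> x i"
proof (rule suminf_le_const[OF summableI])
  fix K
  show "(\<Sum>k<K. (taboo_step S p j ^^ k) f i) \<le> x i"
    using \<open>i \<in> S\<close>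
  proof (induction K arbitrary: i)
    case (Suc K)
    have "(\<Sum>k<Suc K. (taboo_step S p j ^^ k) f i) = f i + (\<Sum>k<K. (taboo_step S p j ^^ Suc k) f i)"
      by (simp only: sum.lessThan_Suc_shift funpow_0)
    also have "\<dots> = f i + taboo_step S p j (\<lambda>l. \<Sum>k<K. (taboo_step S p j ^^ k) f l) i"
      by (simp add: taboo_step_sum)
    also have "\<dots> \<le> f i + taboo_step S p j x i"
      by (intro add_left_mono taboo_step_mono Suc.IH)
    also have "\<dots> \<le> x i"
      by (rule assms(1)) fact
    finally show ?case .
  qed simp
qed

text \<open>The absence of proper closed classes is all that is used of irreducibility.\<close>

definition closed_class :: "'s set \<Rightarrow> ('s \<Rightarrow> 's \<Rightarrow> real) \<Rightarrow> 's set \<Rightarrow> bool" where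
  "closed_class S p C \<longleftrightarrow> C \<subseteq> S \<and> C \<noteq> {} \<and> (\<forall>i\<in>C. \<forall>l\<in>S. p i l \<noteq> 0 \<longrightarrow> l \<in> C)"

text \<open>A single absorbing state has no proper closed class, yet its self-transition probability
  is 1 and removing it leaves nothing. \<open>S_nontrivial\<close> excludes this case and thereby
  secures the denominators \<open>1 - p s s\<close>.\<close>

locale irreducible_semi_markov = semi_markov +
  assumes closed_class_full: "\<And>C. closed_class S (transition_prob Q) C \<Longrightarrow> C = S"
    and S_nontrivial: "\<And>j. S \<noteq> {j}"
begin

abbreviation "p \<equiv> transition_prob Q"

lemma p_self_less_1:
  assumes "s \<in> S"
  shows "p s s < 1"
proof (rule ccontr)
  assume "\<not> p s s < 1"
  then have 1: "p s s = 1"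
    using transition_prob_le_1[OF assms assms] by simp
  have "(\<Sum>j\<in>S - {s}. p s j) = 0"
    using transition_prob_sum[OF assms] finite_S assms by (simp add: sum.remove[of S s] 1)
  then have "\<forall>j\<in>S - {s}. p s j = 0"
    using finite_S transition_prob_nonneg assms by (subst (asm) sum_nonneg_eq_0_iff) auto
  then have "closed_class S p {s}"
    using assms by (auto simp: closed_class_def)
  with closed_class_full S_nontrivial[of s] show False
    by blast
qed

text \<open>\<open>avoid j k i\<close> is the probability of not meeting \<open>j\<close> at times \<open>1, \<dots>, k\<close> when starting from \<open>i\<close>.\<close>

abbreviation avoid :: "'a \<Rightarrow> nat \<Rightarrow> 'a \<Rightarrow> ennreal" where
  "avoid j k \<equiv> (taboo_step S p j ^^ k) (\<lambda>_. 1)"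

lemma taboo_step_one_le:
  assumes "i \<in> S"
  shows "taboo_step S p j (\<lambda>_. 1) i \<le> 1"
proof -
  have "taboo_step S p j (\<lambda>_. 1) i \<le> (\<Sum>l\<in>S. ennreal (p i l))"
    unfolding taboo_step_def using finite_S by (auto intro!: sum_mono2)
  also have "\<dots> = 1"
    using assms transition_prob_nonneg transition_prob_sum by (subst sum_ennreal) auto
  finally show ?thesis .
qed

lemma avoid_Suc_le: "i \<in> S \<Longrightarrow> avoid j (Suc k) i \<le> avoid j k i"
proof (induction k arbitrary: i)
  case 0
  then show ?case using taboo_step_one_le by simp
next
  case (Suc k)
  have "avoid j (Suc (Suc k)) i = taboo_step S p j (avoid j (Suc k)) i"
    by simp
  also have "\<dots> \<le> taboo_step S p j (avoid j k) i"
    by (rule taboo_step_mono) (rule Suc.IH)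
  finally show ?case by simp
qed

lemma avoid_antimono: "i \<in> S \<Longrightarrow> k \<le> l \<Longrightarrow> avoid j l i \<le> avoid j k i"
  by (rule lift_Suc_antimono_le[of "\<lambda>k. avoid j k i"]) (auto intro: avoid_Suc_le simp del: funpow.simps)

lemma avoid_le_1: "i \<in> S \<Longrightarrow> avoid j k i \<le> 1"
  using avoid_antimono[of i 0 k j] by simp

text \<open>The states from which \<open>j\<close> is surely avoided at all times form a closed
  class that never steps into \<open>j\<close>. If it were nonempty it would be all of
  \<open>S\<close>, and then \<open>S - {j}\<close> would be closed.\<close>

lemma avoid_less_1:
  assumes "i \<in> S" and j: "j \<in> S"
  shows "\<exists>k. avoid j k i < 1"
proof (rule ccontr)
  assume "\<not> (\<exists>k. avoid j k i < 1)"
  define B where "B = {l \<in> S. \<forall>k. avoid j k l = 1}"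
  have "i \<in> B"
    using \<open>\<not> _\<close> assms avoid_le_1 by (auto simp: B_def not_less intro: antisym)
  have full: "p h j = 0 \<and> (\<forall>l\<in>S. p h l \<noteq> 0 \<longrightarrow> l \<in> B)" if h: "h \<in> B" for h
  proof -
    have hS: "h \<in> S" using h by (simp add: B_def)
    \<comment> \<open>An average of values at most 1, with total weight at most 1, equals 1 only if
      every value of positive weight is 1.\<close>
    have eq: "avoid j k l = 1" if l: "l \<in> S - {j}" "p h l \<noteq> 0" for l k
    proof (rule ccontr)
      assume "avoid j k l \<noteq> 1"
      then have "avoid j k l < 1"
        using avoid_le_1[of l k j] l by (simp add: less_le)
      have fin: "finite (S - {j})" using finite_S by simp
      have "ennreal (p h l) * avoid j k l < ennreal (p h l) * 1"
        using \<open>avoid j k l < 1\<close> l hS transition_prob_nonneg[of h l]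
        by (intro ennreal_mult_strict_left_mono) auto
      moreover have "(\<Sum>m\<in>S - {j} - {l}. ennreal (p h m) * avoid j k m) \<le> (\<Sum>m\<in>S - {j} - {l}. ennreal (p h m) * 1)"
        by (intro sum_mono mult_left_mono avoid_le_1) auto
      moreover have "(\<Sum>m\<in>S - {j} - {l}. ennreal (p h m) * 1) < \<infinity>"
        using finite_S by (simp add: ennreal_mult_less_top)
      ultimately have "(\<Sum>m\<in>S - {j}. ennreal (p h m) * avoid j k m) < (\<Sum>m\<in>S - {j}. ennreal (p h m) * 1)"
        unfolding sum.remove[OF fin l(1)]
        by (intro ennreal_add_less_le_mono) auto
      then have "avoid j (Suc k) h < taboo_step S p j (\<lambda>_. 1) h"
        by (simp add: taboo_step_def)
      also have "\<dots> \<le> 1"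
        using hS by (rule taboo_step_one_le)
      finally have "avoid j (Suc k) h < 1" .
      moreover have "avoid j (Suc k) h = 1"
        using h unfolding B_def by blast
      ultimately show False
        by (metis less_irrefl)
    qed
    have "avoid j (Suc 0) h = 1"
      using h unfolding B_def by blast
    then have "(\<Sum>l\<in>S - {j}. ennreal (p h l)) = 1"
      by (simp add: taboo_step_def)
    then have "ennreal (\<Sum>l\<in>S - {j}. p h l) = 1"
      using hS transition_prob_nonneg by (subst sum_ennreal[symmetric]) auto
    then have "(\<Sum>l\<in>S - {j}. p h l) = 1"
      by (metis ennreal_eq_1)
    then have "p h j = 0"
      using transition_prob_sum[OF hS] finite_S j by (simp add: sum.remove[of S j])
    then show ?thesis
      using eq by (auto simp: B_def)
  qed
  have "closed_class S p B"
    using \<open>i \<in> B\<close> full by (auto simp: closed_class_def B_def)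
  then have "B = S"
    by (rule closed_class_full)
  \<comment> \<open>\<open>S - {j}\<close> is nonempty by \<open>S_nontrivial\<close>, and by
    \<open>full\<close> no state has a transition into \<open>j\<close>.\<close>
  then have "closed_class S p (S - {j})"
    using full S_nontrivial[of j] j by (auto simp: closed_class_def)
  then have "S - {j} = S"
    by (rule closed_class_full)
  with j show False
    by blast
qed

text \<open>One taboo step need not contract, but \<open>K\<close> steps do. Applying a step to
  \<open>c\<close> times the sum of \<open>avoid j k\<close> over \<open>k < K\<close> shifts the
  index: the term 1 is lost and \<open>avoid j K\<close> gained. The net loss
  \<open>c * (1 - avoid j K i)\<close> must pay for \<open>f i\<close>, which dictates the size of
  \<open>c\<close>.\<close>

lemma taboo_supersolution:
  assumes j: "j \<in> S" and f: "\<And>i. i \<in> S \<Longrightarrow> f i \<noteq> \<infinity>"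
  obtains x :: "'a \<Rightarrow> ennreal" where "\<And>i. x i \<noteq> \<infinity>" "\<And>i. i \<in> S \<Longrightarrow> f i + taboo_step S p j x i \<le> x i"
proof -
  obtain k where k: "\<And>i. i \<in> S \<Longrightarrow> avoid j (k i) i < 1"
    using avoid_less_1[OF _ j] by metis
  \<comment> \<open>A common horizon for all states: the sum exceeds each \<open>k i\<close>, and
    \<open>avoid\<close> decreases in time.\<close>
  define K where "K = (\<Sum>i\<in>S. k i)"
  have K: "avoid j K i < 1" if "i \<in> S" for i
    using k[OF that] avoid_antimono[of i "k i" K j] that finite_S
    by (auto simp: K_def intro: le_less_trans member_le_sum)
  \<comment> \<open>A sum in place of a maximum; it dominates each required quotient.\<close>
  define c where "c = (\<Sum>i\<in>S. f i / (1 - avoid j K i))"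
  have c_fin: "c < \<infinity>"
  proof -
    have "1 - avoid j K i \<noteq> 0" if "i \<in> S" for i
      using K[OF that] by (auto simp: diff_eq_0_iff_ennreal)
    then show ?thesis
      using f finite_S by (auto simp: c_def ennreal_divide_eq_top_iff less_top[symmetric])
  qed
  have c: "f i + c * avoid j K i \<le> c" if i: "i \<in> S" for i
  proof -
    have ne: "1 - avoid j K i \<noteq> 0" "1 - avoid j K i \<noteq> \<infinity>"
      using K[OF i] by (auto simp: diff_eq_0_iff_ennreal)
    have "f i = f i / (1 - avoid j K i) * (1 - avoid j K i)"
      using ne by (subst mult.commute) (simp add: ennreal_times_divide mult.commute[of _ "f i"] mult_divide_eq_ennreal)
    also have "\<dots> \<le> c * (1 - avoid j K i)"
      unfolding c_def using i finite_S by (intro mult_right_mono member_le_sum) auto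
    finally have "f i + c * avoid j K i \<le> c * ((1 - avoid j K i) + avoid j K i)"
      by (simp add: distrib_left add_right_mono)
    also have "(1 - avoid j K i) + avoid j K i = 1"
      using K[OF i] by (intro diff_add_cancel_ennreal) auto
    finally show ?thesis by simp
  qed
  define x where "x i = (if i \<in> S then c * (\<Sum>k<K. avoid j k i) else 0)" for i
  show thesis
  proof
    show "x i \<noteq> \<infinity>" for i
    proof (cases "i \<in> S")
      case True
      have "avoid j k i \<noteq> \<top>" for k
        using avoid_le_1[OF True, of k j] by (auto simp: top_unique)
      with c_fin True show ?thesis
        by (auto simp: x_def ennreal_mult_eq_top_iff)
    qed (simp add: x_def)
    fix i assume i: "i \<in> S"
    have "f i + taboo_step S p j x i = f i + taboo_step S p j (\<lambda>i. c * (\<Sum>k<K. avoid j k i)) i"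
      by (intro arg_cong2[where f="(+)"] taboo_step_cong refl) (simp add: x_def)
    also have "\<dots> = f i + c * (\<Sum>k<K. avoid j (Suc k) i)"
      by (simp add: taboo_step_cmult taboo_step_sum)
    also have "\<dots> \<le> x i"
    proof (cases K)
      case 0
      with K[OF i] show ?thesis by simp
    next
      case (Suc K')
      have "f i + c * (\<Sum>k<K. avoid j (Suc k) i) = (f i + c * avoid j K i) + c * (\<Sum>k<K'. avoid j (Suc k) i)"
        unfolding Suc sum.lessThan_Suc by (simp add: distrib_left ac_simps)
      also have "\<dots> \<le> c * 1 + c * (\<Sum>k<K'. avoid j (Suc k) i)"
        using c[OF i] by (simp add: add_right_mono)
      also have "\<dots> = c * (\<Sum>k<K. avoid j k i)"
        unfolding Suc sum.lessThan_Suc_shift by (simp add: distrib_left)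
      finally show ?thesis
        using i by (simp add: x_def)
    qed
    finally show "f i + taboo_step S p j x i \<le> x i" .
  qed
qed

lemma taboo_suminf_finite:
  assumes "j \<in> S" "\<And>i. i \<in> S \<Longrightarrow> f i \<noteq> \<infinity>" "i \<in> S"
  shows "(\<Sum>k. (taboo_step S p j ^^ k) f i) \<noteq> \<infinity>"
proof -
  obtain x where "\<And>i. x i \<noteq> \<infinity>" "\<And>i. i \<in> S \<Longrightarrow> f i + taboo_step S p j x i \<le> x i"
    using taboo_supersolution[of j f] assms by blast
  with taboo_suminf_le[of S f p j x i] assms(3) show ?thesis
    by (metis infinity_ennreal_def top_unique)
qed

end

section \<open>Recurrence of the irreducible process\<close>

locale irreducible_markov_renewal_process = markov_renewal_process + irreducible_semi_markov S Q
begin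

text \<open>The probability of being in \<open>i\<close> at time \<open>r\<close> and missing
  \<open>j\<close> ever after is at most \<open>avoid j k i\<close> for every \<open>k\<close>.
  These bounds have a finite sum, and a constant series below it must be zero.\<close>

lemma AE_recurrent:
  assumes j: "j \<in> S"
  shows "AE \<omega> in M. \<forall>r. \<exists>q>r. X q \<omega> = j"
  unfolding AE_all_countable
proof
  fix r
  have "AE \<omega> in M. \<forall>i\<in>S. \<not> (X r \<omega> = i \<and> (\<forall>q>r. X q \<omega> \<noteq> j))"
  proof (rule AE_finite_allI[OF finite_S])
    fix i assume i: "i \<in> S"
    define A where "A = {\<omega> \<in> space M. X r \<omega> = i}"
    define Z where "Z = {\<omega> \<in> space M. X r \<omega> = i \<and> (\<forall>q>r. X q \<omega> \<noteq> j)}"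
    have A: "A \<in> sets (history r)"
      using pred_history_X[of r r i] by (simp add: A_def pred_def)
    have [measurable]: "A \<in> sets M" "Z \<in> sets M"
      by (simp_all add: A_def Z_def)
    have le: "emeasure M Z \<le> avoid j k i" for k
    proof -
      have "emeasure M Z \<le> emeasure M (A \<inter> {\<omega> \<in> space M. \<forall>q\<in>{r<..r+k}. X q \<omega> \<noteq> j})"
        by (intro emeasure_mono) (auto simp: Z_def A_def)
      also have "\<dots> = emeasure M A * avoid j k i"
        by (rule emeasure_avoid) (use A i in \<open>auto simp: A_def\<close>)
      also have "\<dots> \<le> 1 * avoid j k i"
        by (intro mult_right_mono) (auto simp: emeasure_le_1)
      finally show ?thesis by simp
    qed
    have "(\<Sum>k::nat. emeasure M Z) \<le> (\<Sum>k. avoid j k i)"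
      by (intro suminf_le le summableI)
    moreover have "(\<Sum>k. avoid j k i) \<noteq> \<infinity>"
      using j i by (intro taboo_suminf_finite) auto
    ultimately have "(\<Sum>k::nat. emeasure M Z) \<noteq> \<infinity>"
      by (auto simp: top_unique)
    then have "emeasure M Z = 0"
      by (metis nn_integral_const nn_integral_count_space_nat emeasure_count_space_infinite
          infinite_UNIV_nat ennreal_mult_eq_top_iff infinity_ennreal_def space_count_space top.extremum
          subset_UNIV)
    then show "AE \<omega> in M. \<not> (X r \<omega> = i \<and> (\<forall>q>r. X q \<omega> \<noteq> j))"
      by (intro AE_I[of _ _ Z]) (auto simp: Z_def)
  qed
  then show "AE \<omega> in M. \<exists>q>r. X q \<omega> = j"
    using X_in_S[of r] by eventually_elim blast
qed

lemma AE_infinitely_often: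
  "AE \<omega> in M. \<forall>j\<in>S. infinite {k. X k \<omega> = j}"
proof (rule AE_finite_allI[OF finite_S])
  fix j assume "j \<in> S"
  show "AE \<omega> in M. infinite {k. X k \<omega> = j}"
    using AE_recurrent[OF \<open>j \<in> S\<close>] by eventually_elim (simp add: infinite_nat_iff_unbounded)
qed

end

subsection \<open>The censored kernel\<close>

context irreducible_semi_markov
begin

text \<open>\<open>sojourn s m i j\<close> is the law of the time from \<open>i\<close> to \<open>j\<close> along a path that makes exactly
  \<open>m\<close> intermediate visits, all of them to \<open>s\<close>.\<close>

primrec sojourn :: "'a \<Rightarrow> nat \<Rightarrow> 'a \<Rightarrow> 'a \<Rightarrow> real measure" where
  "sojourn s 0 i j = interval_measure (Q i j)"
| "sojourn s (Suc m) i j = (interval_measure (Q i s) \<star> sojourn s m s j)"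

lemma sets_sojourn [simp, measurable_cong]: "sets (sojourn s m i j) = sets borel"
  by (cases m) auto

lemma space_sojourn [simp]: "space (sojourn s m i j) = UNIV"
  by (cases m) auto

lemma finite_measure_sojourn:
  "s \<in> S \<Longrightarrow> i \<in> S \<Longrightarrow> j \<in> S \<Longrightarrow> finite_measure (sojourn s m i j)"
  by (induction m arbitrary: i) (auto intro!: finite_measure_step convolution_finite)

lemma emeasure_sojourn_Suc_UNIV:
  assumes "s \<in> S" "i \<in> S" "j \<in> S"
  shows "emeasure (sojourn s (Suc m) i j) UNIV = ennreal (p i s) * emeasure (sojourn s m s j) UNIV"
  using assms
  by (simp add: emeasure_convolution_UNIV finite_measure_step finite_measure_sojourn emeasure_step_UNIV)

lemma AE_sojourn_nonneg:
  assumes "s \<in> S" "i \<in> S" "j \<in> S"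
  shows "AE t in sojourn s m i j. 0 \<le> t"
  using assms
proof (induction m arbitrary: i)
  case 0
  then show ?case by (simp only: sojourn.simps AE_step_nonneg)
next
  case (Suc m)
  then show ?case
    unfolding sojourn.simps
    by (intro AE_nonneg_convolution finite_measure_step finite_measure_sojourn AE_step_nonneg Suc.IH) auto
qed

section \<open>Mass and mean of one step of the censored process\<close>

definition reduced_law :: "'a \<Rightarrow> 'a \<Rightarrow> 'a \<Rightarrow> real measure" where
  "reduced_law s i j = sum_measure (\<lambda>m. sojourn s m i j)"

text \<open>The value 0 outside \<open>S - {s}\<close> makes the kernel, evaluated at the current
  reduced state, a finite sum of indicators at every point and not just almost everywhere.
  Measurability with respect to the reduced history rests on this.\<close>

definition reduced_kernel :: "'a \<Rightarrow> 'a \<Rightarrow> 'a \<Rightarrow> real \<Rightarrow> real" where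
  "reduced_kernel s i j t = (if i \<in> S - {s} then measure (reduced_law s i j) {..t} else 0)"

lemma sets_reduced_law [simp, measurable_cong]: "sets (reduced_law s i j) = sets borel"
  by (simp add: reduced_law_def)

lemma emeasure_reduced_law:
  "B \<in> sets borel \<Longrightarrow> emeasure (reduced_law s i j) B = (\<Sum>m. emeasure (sojourn s m i j) B)"
  by (simp add: reduced_law_def emeasure_sum_measure)

lemma suminf_sojourn_UNIV:
  assumes "s \<in> S" "j \<in> S"
  shows "(\<Sum>m. emeasure (sojourn s m s j) UNIV) = ennreal (p s j / (1 - p s s))"
proof -
  \<comment> \<open>The affine series with zero inhomogeneity is the geometric series.\<close>
  have "(\<Sum>m. emeasure (sojourn s m s j) UNIV) =
    ennreal (enn2real (emeasure (sojourn s 0 s j) UNIV + (\<Sum>m::nat. 0)) / (1 - p s s))"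
    using assms p_self_less_1 transition_prob_nonneg
    by (intro ennreal_affine_series) (simp_all only: emeasure_sojourn_Suc_UNIV, auto simp: emeasure_step_UNIV)
  then show ?thesis
    using assms transition_prob_nonneg by (simp add: emeasure_step_UNIV)
qed

lemma emeasure_reduced_law_UNIV:
  assumes "s \<in> S" "i \<in> S" "j \<in> S"
  shows "emeasure (reduced_law s i j) UNIV = ennreal (p i j + p i s * p s j / (1 - p s s))"
proof -
  have "emeasure (reduced_law s i j) UNIV =
      ennreal (p i j) + ennreal (p i s) * (\<Sum>m. emeasure (sojourn s m s j) UNIV)"
    by (subst emeasure_reduced_law, simp, subst ennreal_suminf_split_head)
      (simp only: emeasure_sojourn_Suc_UNIV[OF assms] ennreal_suminf_cmult, simp add: emeasure_step_UNIV assms)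
  also have "\<dots> = ennreal (p i j + p i s * (p s j / (1 - p s s)))"
    using assms transition_prob_nonneg p_self_less_1[OF assms(1)]
    by (simp add: suminf_sojourn_UNIV flip: ennreal_mult' ennreal_plus)
  finally show ?thesis
    by simp
qed

lemma finite_measure_reduced_law:
  assumes "s \<in> S" "i \<in> S" "j \<in> S"
  shows "finite_measure (reduced_law s i j)"
  by (rule finite_measureI) (simp add: reduced_law_def emeasure_reduced_law_UNIV[OF assms, unfolded reduced_law_def])

lemma measure_reduced_law_neg:
  assumes "s \<in> S" "i \<in> S" "j \<in> S"
  shows "measure (reduced_law s i j) {..<0} = 0"
proof -
  have "emeasure (sojourn s m i j) {..<0} = 0" for m
    using AE_sojourn_nonneg[OF assms, of m] by (subst (asm) AE_iff_measurable[OF _ refl]) (auto simp: not_le lessThan_def)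
  then show ?thesis
    by (simp add: measure_def emeasure_reduced_law)
qed

lemma sum_remove_p:
  assumes "s \<in> S" "i \<in> S"
  shows "(\<Sum>j\<in>S - {s}. p i j) = 1 - p i s"
  using transition_prob_sum[OF assms(2)] finite_S assms by (simp add: sum.remove[of S s])

lemma semi_markov_kernel_reduced:
  assumes s: "s \<in> S"
  shows "semi_markov_kernel (S - {s}) (reduced_kernel s)"
  unfolding semi_markov_kernel_def
proof (intro conjI ballI)
  have borel: "finite_borel_measure (reduced_law s i j)" if "i \<in> S" "j \<in> S" for i j
    using finite_measure_reduced_law[OF s that]
    by (simp add: finite_borel_measure_def finite_borel_measure_axioms_def)
  have eq: "reduced_kernel s i j = cdf (reduced_law s i j)" if "i \<in> S - {s}" for i j
    using that by (auto simp: reduced_kernel_def cdf_def)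
  fix i assume i: "i \<in> S - {s}"
  {
    fix j assume j: "j \<in> S - {s}"
    interpret finite_borel_measure "reduced_law s i j"
      using i j by (intro borel) auto
    show "mono (reduced_kernel s i j)"
      using i j by (simp add: eq mono_def cdf_nondecreasing)
    show "\<forall>t. continuous (at_right t) (reduced_kernel s i j)"
      using i j by (simp add: eq cdf_is_right_cont)
    show "\<forall>t<0. reduced_kernel s i j t = 0"
    proof (intro allI impI)
      fix t :: real assume "t < 0"
      then have "measure (reduced_law s i j) {..t} \<le> measure (reduced_law s i j) {..<0}"
        by (intro finite_measure_mono) auto
      then show "reduced_kernel s i j t = 0"
        using measure_reduced_law_neg[of s i j] s i j by (simp add: reduced_kernel_def measure_le_0_iff)
    qed
  }
  have "((\<lambda>t. \<Sum>j\<in>S - {s}. reduced_kernel s i j t) \<longlongrightarrow>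
     (\<Sum>j\<in>S - {s}. measure (reduced_law s i j) (space (reduced_law s i j)))) at_top"
    using i by (intro tendsto_sum) (simp add: eq finite_borel_measure.cdf_lim_at_top borel)
  also have "(\<Sum>j\<in>S - {s}. measure (reduced_law s i j) (space (reduced_law s i j))) =
      (\<Sum>j\<in>S - {s}. p i j + p i s * p s j / (1 - p s s))"
  proof (intro sum.cong refl)
    fix j assume j: "j \<in> S - {s}"
    have "space (reduced_law s i j) = UNIV" by (simp add: reduced_law_def)
    then show "measure (reduced_law s i j) (space (reduced_law s i j)) = p i j + p i s * p s j / (1 - p s s)"
      using i j s p_self_less_1[OF s]
      by (simp add: measure_def emeasure_reduced_law_UNIV transition_prob_nonneg del: ennreal_plus)
  qed
  also have "\<dots> = (\<Sum>j\<in>S - {s}. p i j) + p i s / (1 - p s s) * (\<Sum>j\<in>S - {s}. p s j)"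
    by (simp add: sum.distrib sum_distrib_left)
  \<comment> \<open>From \<open>s\<close> the other states receive mass \<open>1 - p s s\<close>,
    which cancels the denominator.\<close>
  also have "\<dots> = 1"
    using i s p_self_less_1[OF s] by (simp add: sum_remove_p)
  finally show "((\<lambda>t. \<Sum>j\<in>S - {s}. reduced_kernel s i j t) \<longlongrightarrow> 1) at_top" .
qed

lemma semi_markov_reduced: "s \<in> S \<Longrightarrow> semi_markov (S - {s}) (reduced_kernel s)"
  using finite_S semi_markov_kernel_reduced by (simp add: semi_markov_def)

text \<open>Masses and means are computed for \<open>reduced_law\<close>, whereas
  \<open>mean_holding_time\<close> sees a kernel only through
  \<open>interval_measure\<close>.\<close>

lemma interval_measure_reduced_kernel:
  assumes s: "s \<in> S" and ij: "i \<in> S - {s}" "j \<in> S - {s}"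
  shows "interval_measure (reduced_kernel s i j) = reduced_law s i j"
proof (rule finite_measure_eqI_atMost)
  interpret R: semi_markov "S - {s}" "reduced_kernel s"
    using s by (rule semi_markov_reduced)
  show "finite_measure (interval_measure (reduced_kernel s i j))"
    using ij by (rule R.finite_measure_step)
  show "finite_measure (reduced_law s i j)"
    using s ij by (intro finite_measure_reduced_law) auto
  show "measure (interval_measure (reduced_kernel s i j)) {..t} = measure (reduced_law s i j) {..t}" for t
    using ij by (subst R.measure_step_atMost) (auto simp: reduced_kernel_def)
qed auto

lemma transition_prob_reduced:
  assumes s: "s \<in> S" and ij: "i \<in> S - {s}" "j \<in> S - {s}"
  shows "transition_prob (reduced_kernel s) i j = p i j + p i s * p s j / (1 - p s s)"
proof -
  interpret R: semi_markov "S - {s}" "reduced_kernel s"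
    using s by (rule semi_markov_reduced)
  have "ennreal (transition_prob (reduced_kernel s) i j) = ennreal (p i j + p i s * p s j / (1 - p s s))"
    using R.emeasure_step_UNIV[OF ij] interval_measure_reduced_kernel[OF assms] s ij
    by (simp add: emeasure_reduced_law_UNIV)
  then show ?thesis
    using s ij transition_prob_nonneg p_self_less_1[OF s] R.transition_prob_nonneg[OF ij]
    by (subst (asm) ennreal_inj) auto
qed

lemma nn_integral_sojourn_Suc:
  assumes "s \<in> S" "i \<in> S" "j \<in> S"
  shows "(\<integral>\<^sup>+t. ennreal t \<partial>sojourn s (Suc m) i j) =
    (\<integral>\<^sup>+t. ennreal t \<partial>interval_measure (Q i s)) * emeasure (sojourn s m s j) UNIV
    + ennreal (p i s) * (\<integral>\<^sup>+t. ennreal t \<partial>sojourn s m s j)"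
  unfolding sojourn.simps using assms
  by (subst nn_integral_ennreal_convolution)
    (auto intro: finite_measure_step finite_measure_sojourn AE_step_nonneg AE_sojourn_nonneg simp: emeasure_step_UNIV)

text \<open>The chain leaves \<open>s\<close> with probability one. This normalisation eliminates
  the masses of the remaining excursions from the mean formulas.\<close>

lemma sum_suminf_sojourn_UNIV:
  assumes s: "s \<in> S"
  shows "(\<Sum>m. \<Sum>j\<in>S - {s}. emeasure (sojourn s m s j) UNIV) = 1"
proof -
  have "(\<Sum>m. \<Sum>j\<in>S - {s}. emeasure (sojourn s m s j) UNIV) = (\<Sum>j\<in>S - {s}. ennreal (p s j / (1 - p s s)))"
    by (subst suminf_sum) (auto intro: summableI simp: suminf_sojourn_UNIV s)
  also have "\<dots> = ennreal (\<Sum>j\<in>S - {s}. p s j / (1 - p s s))"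
    using s transition_prob_nonneg p_self_less_1[OF s] by (intro sum_ennreal) auto
  also have "(\<Sum>j\<in>S - {s}. p s j / (1 - p s s)) = 1"
    using sum_remove_p[OF s s] p_self_less_1[OF s] by (simp flip: sum_divide_distrib)
  finally show ?thesis by simp
qed

text \<open>Each step from \<open>s\<close> takes \<open>\<mu>\<close> of \<open>s\<close> on
  average, and the number of steps until departure has mean \<open>1 / (1 - p s s)\<close>. In the
  recursion over \<open>m\<close>, the return steps from \<open>s\<close> to \<open>s\<close> carry
  total weight 1, so they complete the term for \<open>m = 0\<close> to the full mean holding time
  of \<open>s\<close>.\<close>

lemma suminf_mean_sojourn:
  assumes s: "s \<in> S" and fin: "mean_holding_time S Q s \<noteq> \<infinity>"
  shows "(\<Sum>m. \<Sum>j\<in>S - {s}. \<integral>\<^sup>+t. ennreal t \<partial>sojourn s m s j) =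
    ennreal (enn2real (mean_holding_time S Q s) / (1 - p s s))"
proof -
  let ?e = "\<integral>\<^sup>+t. ennreal t \<partial>interval_measure (Q s s)"
  let ?a = "\<lambda>m. \<Sum>j\<in>S - {s}. \<integral>\<^sup>+t. ennreal t \<partial>sojourn s m s j"
  let ?c = "\<lambda>m. ?e * (\<Sum>j\<in>S - {s}. emeasure (sojourn s m s j) UNIV)"
  have total: "?a 0 + (\<Sum>m. ?c m) = mean_holding_time S Q s"
    using s finite_S
    by (simp add: sum_suminf_sojourn_UNIV mean_holding_time_eq sum.remove[of S s] add.commute)
  have "(\<Sum>m. ?a m) = ennreal (enn2real (?a 0 + (\<Sum>m. ?c m)) / (1 - p s s))"
  proof (rule ennreal_affine_series)
    show "?a (Suc m) = ?c m + ennreal (p s s) * ?a m" for m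
      using s by (subst sum.cong[OF refl nn_integral_sojourn_Suc])
        (auto simp: sum.distrib sum_distrib_left)
    show "0 \<le> p s s" "p s s < 1"
      using s transition_prob_nonneg p_self_less_1 by auto
    show "?a 0 + (\<Sum>m. ?c m) \<noteq> \<infinity>"
      unfolding total by (rule fin)
  qed
  then show ?thesis
    by (simp only: total)
qed

lemma mean_holding_time_reduced:
  assumes s: "s \<in> S" and i: "i \<in> S - {s}"
    and fin: "mean_holding_time S Q s \<noteq> \<infinity>" "mean_holding_time S Q i \<noteq> \<infinity>"
  shows "mean_holding_time (S - {s}) (reduced_kernel s) i =
    ennreal (enn2real (mean_holding_time S Q i) + p i s * enn2real (mean_holding_time S Q s) / (1 - p s s))"
proof -
  interpret R: semi_markov "S - {s}" "reduced_kernel s"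
    using s by (rule semi_markov_reduced)
  let ?e = "\<lambda>j. \<integral>\<^sup>+t. ennreal t \<partial>interval_measure (Q i j)"
  have iS: "i \<in> S" using i by simp
  have "mean_holding_time (S - {s}) (reduced_kernel s) i =
      (\<Sum>j\<in>S - {s}. \<Sum>m. \<integral>\<^sup>+t. ennreal t \<partial>sojourn s m i j)"
    unfolding R.mean_holding_time_eq using s i
    by (intro sum.cong refl) (simp add: interval_measure_reduced_kernel reduced_law_def nn_integral_sum_measure)
  also have "\<dots> = (\<Sum>j\<in>S - {s}. ?e j + (\<Sum>m. \<integral>\<^sup>+t. ennreal t \<partial>sojourn s (Suc m) i j))"
    by (subst ennreal_suminf_split_head) simp
  also have "\<dots> = (\<Sum>j\<in>S - {s}. ?e j) + (\<Sum>m. \<Sum>j\<in>S - {s}. \<integral>\<^sup>+t. ennreal t \<partial>sojourn s (Suc m) i j)"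
    unfolding sum.distrib by (subst suminf_sum) (auto intro: summableI)
  also have "(\<Sum>m. \<Sum>j\<in>S - {s}. \<integral>\<^sup>+t. ennreal t \<partial>sojourn s (Suc m) i j) =
     (\<Sum>m. ?e s * (\<Sum>j\<in>S - {s}. emeasure (sojourn s m s j) UNIV)
        + ennreal (p i s) * (\<Sum>j\<in>S - {s}. \<integral>\<^sup>+t. ennreal t \<partial>sojourn s m s j))"
    using s iS by (intro suminf_cong, subst sum.cong[OF refl nn_integral_sojourn_Suc])
      (auto simp: sum.distrib sum_distrib_left)
  \<comment> \<open>The step into \<open>s\<close> contributes \<open>?e s\<close> once, because the
    excursions that may follow have total mass 1.\<close>
  also have "\<dots> = ?e s + ennreal (p i s) * ennreal (enn2real (mean_holding_time S Q s) / (1 - p s s))"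
    by (subst suminf_add[symmetric])
      (auto intro: summableI simp: sum_suminf_sojourn_UNIV suminf_mean_sojourn s fin[unfolded infinity_ennreal_def])
  also have "(\<Sum>j\<in>S - {s}. ?e j) + \<dots> = mean_holding_time S Q i +
      ennreal (p i s) * ennreal (enn2real (mean_holding_time S Q s) / (1 - p s s))"
    using s finite_S by (simp add: mean_holding_time_eq sum.remove[of S s] ac_simps)
  also have "mean_holding_time S Q i = ennreal (enn2real (mean_holding_time S Q i))"
    using fin(2) by (simp add: ennreal_enn2real_if)
  also have "\<dots> + ennreal (p i s) * ennreal (enn2real (mean_holding_time S Q s) / (1 - p s s)) =
    ennreal (enn2real (mean_holding_time S Q i) + p i s * (enn2real (mean_holding_time S Q s) / (1 - p s s)))"
    using transition_prob_nonneg[OF iS s] p_self_less_1[OF s]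
    by (subst ennreal_mult[symmetric], simp_all add: ennreal_plus[symmetric] del: ennreal_plus)
  finally show ?thesis by simp
qed

end

subsection \<open>The censored process\<close>

lemma card_less_Suc_member:
  "card {l::nat. l < Suc r \<and> P l} = card {l. l < r \<and> P l} + (if P r then 1 else 0)"
proof -
  have "{l. l < Suc r \<and> P l} = {l. l < r \<and> P l} \<union> (if P r then {r} else {})"
    by (auto simp: less_Suc_eq)
  then show ?thesis
    by (simp add: card_Un_disjoint)
qed

text \<open>The count rises by at most one per index, so every value below the present count is the
  rank of an earlier member.\<close>

lemma ex_rank_less:
  assumes "l < card {i::nat. i < r \<and> P i}"
  shows "\<exists>q<r. P q \<and> card {i. i < q \<and> P i} = l"
  using assms
proof (induction r)
  case (Suc r)
  show ?case
  proof (cases "l < card {i. i < r \<and> P i}")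
    case True
    with Suc.IH show ?thesis by (meson less_Suc_eq)
  next
    case False
    with Suc.prems have "P r" "card {i. i < r \<and> P i} = l"
      by (auto simp: card_less_Suc_member split: if_splits)
    then show ?thesis by blast
  qed
qed simp

lemma emeasure_eq_suminf_Int:
  assumes [measurable]: "\<And>n::nat. F n \<in> sets M" "Y \<in> sets M"
    and disj: "disjoint_family F" and AE: "AE \<omega> in M. \<omega> \<in> Y \<longrightarrow> (\<exists>n. \<omega> \<in> F n)"
  shows "emeasure M Y = (\<Sum>n. emeasure M (Y \<inter> F n))"
proof -
  have "emeasure M Y = emeasure M (\<Union>n. Y \<inter> F n)"
    using AE by (intro emeasure_eq_AE) auto
  also have "\<dots> = (\<Sum>n. emeasure M (Y \<inter> F n))"
    using disj by (intro suminf_emeasure[symmetric]) (auto simp: disjoint_family_on_def)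
  finally show ?thesis .
qed

context irreducible_markov_renewal_process
begin

text \<open>The time of the first step and the remaining time have a product as joint law, and
  addition maps a product to a convolution. By uniqueness of product measures only rectangles have
  to be checked, where the induction hypothesis applies from time \<open>Suc r\<close>.\<close>

lemma sojourn_emeasure:
  assumes s: "s \<in> S" and A: "A \<in> sets (history r)" "\<And>\<omega>. \<omega> \<in> A \<Longrightarrow> X r \<omega> = i"
    and ij: "i \<in> S" "j \<in> S" and B: "B \<in> sets borel"
  shows "emeasure M (A \<inter> {\<omega> \<in> space M. (\<forall>q\<in>{r<..r+m}. X q \<omega> = s) \<and> X (Suc (r+m)) \<omega> = j \<and>
      T (Suc (r+m)) \<omega> - T r \<omega> \<in> B}) = emeasure M A * emeasure (sojourn s m i j) B"
  using A ij(1) B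
proof (induction m arbitrary: r A i B)
  case 0
  then show ?case
    using step_emeasure[of A r i j B] ij(2) by simp
next
  case (Suc m)
  note [measurable] = \<open>B \<in> sets borel\<close>
  have [measurable]: "A \<in> sets M"
    using Suc.prems(1) sets_history_subset by blast
  define G where "G = {\<omega> \<in> space M. (\<forall>q\<in>{Suc r<..Suc r+m}. X q \<omega> = s) \<and> X (Suc (Suc r+m)) \<omega> = j}"
  define E where "E = A \<inter> {\<omega> \<in> space M. X (Suc r) \<omega> = s} \<inter> G"
  define D where "D \<omega> = T (Suc r) \<omega> - T r \<omega>" for \<omega>
  define D' where "D' \<omega> = T (Suc (Suc r+m)) \<omega> - T (Suc r) \<omega>" for \<omega>
  have [measurable]: "G \<in> sets M" "E \<in> sets M" "D \<in> borel_measurable M" "D' \<in> borel_measurable M"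
    by (simp_all add: G_def E_def D_def[abs_def] D'_def[abs_def])
  define J where "J = distr (density M (indicator E)) (borel \<Otimes>\<^sub>M borel) (\<lambda>\<omega>. (D \<omega>, D' \<omega>))"
  \<comment> \<open>Keeping the weight \<open>emeasure M A\<close> inside \<open>N\<close> makes
    \<open>J\<close> a product without dividing by the mass of a possibly null event.\<close>
  define N where "N = density (interval_measure (Q i s)) (\<lambda>_. emeasure M A)"
  interpret step: finite_measure "interval_measure (Q i s)"
    using Suc.prems s by (intro finite_measure_step)
  interpret soj: finite_measure "sojourn s m s j"
    using s ij by (intro finite_measure_sojourn)
  have N_emeasure: "emeasure N B1 = emeasure M A * emeasure (interval_measure (Q i s)) B1"
    if "B1 \<in> sets borel" for B1
    using that by (simp add: N_def emeasure_density_const)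
  have N_sets [simp, measurable_cong]: "sets N = sets borel"
    by (simp add: N_def)
  have N_fin: "finite_measure N"
  proof (rule finite_measureI)
    have "emeasure N UNIV \<noteq> \<infinity>"
      using N_emeasure[of UNIV] step.emeasure_finite[of UNIV] emeasure_finite[of A]
      by (simp add: ennreal_mult_eq_top_iff)
    then show "emeasure N (space N) \<noteq> \<infinity>" by (simp add: N_def)
  qed
  have J_emeasure: "emeasure J C = emeasure M (E \<inter> {\<omega> \<in> space M. (D \<omega>, D' \<omega>) \<in> C})"
    if [measurable]: "C \<in> sets (borel \<Otimes>\<^sub>M borel)" for C
  proof -
    have "emeasure J C = (\<integral>\<^sup>+\<omega>. indicator E \<omega> * indicator ((\<lambda>\<omega>. (D \<omega>, D' \<omega>)) -` C \<inter> space M) \<omega> \<partial>M)"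
      unfolding J_def by (subst emeasure_distr) (auto simp: emeasure_density)
    also have "\<dots> = (\<integral>\<^sup>+\<omega>. indicator (E \<inter> {\<omega> \<in> space M. (D \<omega>, D' \<omega>) \<in> C}) \<omega> \<partial>M)"
      by (intro nn_integral_cong) (auto simp: indicator_def)
    finally show ?thesis by simp
  qed
  have "N \<Otimes>\<^sub>M sojourn s m s j = J"
  proof (rule pair_measure_eqI)
    show "sigma_finite_measure N"
      using N_fin by (rule finite_measure.sigma_finite_measure)
    show "sigma_finite_measure (sojourn s m s j)" ..
    show "sets (N \<Otimes>\<^sub>M sojourn s m s j) = sets J"
      unfolding J_def sets_distr by (intro sets_pair_measure_cong N_sets sets_sojourn)
    fix B1 B2 assume "B1 \<in> sets N" "B2 \<in> sets (sojourn s m s j)"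
    then have [measurable]: "B1 \<in> sets borel" "B2 \<in> sets borel"
      by auto
    \<comment> \<open>The condition on the first holding time moves into the history event, leaving
      only the second factor to the induction hypothesis.\<close>
    define A' where "A' = A \<inter> {\<omega> \<in> space M. X (Suc r) \<omega> = s \<and> D \<omega> \<in> B1}"
    have A': "A' \<in> sets (history (Suc r))"
    proof -
      have [measurable]: "D \<in> borel_measurable (history (Suc r))"
        unfolding D_def[abs_def] by (intro borel_measurable_diff measurable_history_T) auto
      have [measurable]: "Measurable.pred (history (Suc r)) (\<lambda>\<omega>. X (Suc r) \<omega> = s)"
        by (rule pred_history_X) simp
      have [measurable]: "A \<in> sets (history (Suc r))"
        using Suc.prems(1) sets_history_mono[of r "Suc r"] by auto
      have "A \<inter> {\<omega> \<in> space (history (Suc r)). X (Suc r) \<omega> = s \<and> D \<omega> \<in> B1} \<in> sets (history (Suc r))"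
        by measurable
      then show ?thesis
        by (simp add: A'_def)
    qed
    have "emeasure J (B1 \<times> B2) = emeasure M (A' \<inter> {\<omega> \<in> space M. (\<forall>q\<in>{Suc r<..Suc r+m}. X q \<omega> = s) \<and>
        X (Suc (Suc r+m)) \<omega> = j \<and> T (Suc (Suc r+m)) \<omega> - T (Suc r) \<omega> \<in> B2})"
      by (subst J_emeasure) (auto simp: E_def G_def A'_def D'_def intro!: arg_cong[where f="emeasure M"])
    also have "\<dots> = emeasure M A' * emeasure (sojourn s m s j) B2"
      by (rule Suc.IH) (use A' s in \<open>auto simp: A'_def\<close>)
    also have "emeasure M A' = emeasure M A * emeasure (interval_measure (Q i s)) B1"
      unfolding A'_def D_def using Suc.prems s by (intro step_emeasure) auto
    finally show "emeasure N B1 * emeasure (sojourn s m s j) B2 = emeasure J (B1 \<times> B2)"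
      by (simp add: N_emeasure)
  qed
  have split: "{r<..r + Suc m} = insert (Suc r) {Suc r<..Suc r + m}"
    by auto
  have "A \<inter> {\<omega> \<in> space M. (\<forall>q\<in>{r<..r + Suc m}. X q \<omega> = s) \<and> X (Suc (r + Suc m)) \<omega> = j \<and>
      T (Suc (r + Suc m)) \<omega> - T r \<omega> \<in> B}
     = E \<inter> {\<omega> \<in> space M. (D \<omega>, D' \<omega>) \<in> (\<lambda>(x, y). x + y) -` B}"
    unfolding split by (auto simp: E_def G_def D_def D'_def)
  also have "emeasure M \<dots> = emeasure J ((\<lambda>(x, y). x + y) -` B)"
  proof (rule J_emeasure[symmetric])
    have "(\<lambda>(x, y). x + y) -` B \<inter> space (borel \<Otimes>\<^sub>M borel :: (real \<times> real) measure) \<in> sets (borel \<Otimes>\<^sub>M borel)"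
      using _ \<open>B \<in> sets borel\<close> by (rule measurable_sets) measurable
    then show "(\<lambda>(x, y). x + y) -` B \<in> sets (borel \<Otimes>\<^sub>M borel :: (real \<times> real) measure)"
      by (simp add: space_pair_measure)
  qed
  also have "\<dots> = emeasure (N \<star> sojourn s m s j) B"
    unfolding convolution_def \<open>N \<Otimes>\<^sub>M sojourn s m s j = J\<close>
    by (subst emeasure_distr) (auto simp: J_def space_pair_measure)
  also have "\<dots> = (\<integral>\<^sup>+x. emeasure (sojourn s m s j) {y. y + x \<in> B} \<partial>N)"
    using N_fin by (intro convolution_emeasure) (auto simp: N_def soj.finite_measure_axioms)
  also have "\<dots> = emeasure M A * (\<integral>\<^sup>+x. emeasure (sojourn s m s j) {y. y + x \<in> B} \<partial>interval_measure (Q i s))"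
  proof -
    have "(\<lambda>x. emeasure (sojourn s m s j) (Pair x -` {(x, y). y + x \<in> B})) \<in> borel_measurable borel"
    proof (rule soj.measurable_emeasure_Pair)
      have "{z \<in> space (borel \<Otimes>\<^sub>M sojourn s m s j). snd z + fst z \<in> B} \<in> sets (borel \<Otimes>\<^sub>M sojourn s m s j)"
        by measurable
      moreover have "{(x, y). y + x \<in> B} = {z \<in> space (borel \<Otimes>\<^sub>M sojourn s m s j). snd z + fst z \<in> B}"
        by (auto simp: space_pair_measure)
      ultimately show "{(x, y). y + x \<in> B} \<in> sets (borel \<Otimes>\<^sub>M sojourn s m s j)"
        by (simp only:)
    qed
    then show ?thesis
      unfolding N_def by (subst nn_integral_density) (auto simp: nn_integral_cmult vimage_def)
  qed
  also have "\<dots> = emeasure M A * emeasure (sojourn s (Suc m) i j) B"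
    by (simp, subst convolution_emeasure)
      (auto simp: step.finite_measure_axioms soj.finite_measure_axioms)
  finally show ?case .
qed

text \<open>\<open>visit s k r\<close> says that \<open>reduction_index\<close> takes the value \<open>r\<close> at \<open>k\<close>; phrased by counting, it
  visibly depends on the first \<open>r\<close> steps only, also on paths that leave \<open>s\<close> finitely often.\<close>

definition visit :: "'b \<Rightarrow> nat \<Rightarrow> nat \<Rightarrow> 'a set" where
  "visit s k r = {\<omega> \<in> space M. X r \<omega> \<noteq> s \<and> card {l. l < r \<and> X l \<omega> \<noteq> s} = k}"

lemma visit_history: "visit s k r \<in> sets (history r)"
proof -
  have before: "Measurable.pred (history r) (\<lambda>\<omega>. l < r \<and> X l \<omega> \<noteq> s)" for l
  proof (cases "l < r")
    case True
    then have [measurable]: "Measurable.pred (history r) (\<lambda>\<omega>. X l \<omega> = s)"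
      by (intro pred_history_X) simp
    show ?thesis by measurable
  qed simp
  have "(\<lambda>\<omega>. card {l. l < r \<and> X l \<omega> \<noteq> s}) \<in> measurable (history r) (count_space UNIV)"
  proof (rule measurable_card)
    show "{\<omega> \<in> space (history r). l \<in> {l. l < r \<and> X l \<omega> \<noteq> s}} \<in> sets (history r)" for l
      using before[of l] by (simp only: pred_def mem_Collect_eq)
  qed
  then have "(\<lambda>\<omega>. card {l. l < r \<and> X l \<omega> \<noteq> s}) -` {k} \<inter> space (history r) \<in> sets (history r)"
    by (rule measurable_sets) simp
  moreover have "{\<omega> \<in> space (history r). X r \<omega> = s} \<in> sets (history r)"
    using pred_history_X[of r r s] by (simp only: pred_def order_refl)
  moreover have "visit s k r = ((\<lambda>\<omega>. card {l. l < r \<and> X l \<omega> \<noteq> s}) -` {k} \<inter> space (history r))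
      - {\<omega> \<in> space (history r). X r \<omega> = s}"
    by (auto simp: visit_def)
  ultimately show ?thesis
    by (simp only: sets.Diff)
qed

lemma visit_sets [measurable]: "visit s k r \<in> sets M"
  using visit_history sets_history_subset by blast

lemma reduction_index_visit: "\<omega> \<in> visit s k r \<Longrightarrow> reduction_index s X k \<omega> = r"
  unfolding reduction_index_def visit_def by (intro enumerate_eqI) auto

lemma reduced_visit:
  assumes "\<omega> \<in> visit s k r"
  shows "reduced_X s X k \<omega> = X r \<omega>" "reduced_T s X T k \<omega> = T r \<omega>"
  using reduction_index_visit[OF assms] by (simp_all add: reduced_X_def reduced_T_def)

lemma disjoint_visit: "disjoint_family (visit s k)"
  by (auto simp: disjoint_family_on_def dest: reduction_index_visit)

lemma visit_earlier: "\<omega> \<in> visit s k r \<Longrightarrow> l \<le> k \<Longrightarrow> \<exists>q\<le>r. \<omega> \<in> visit s l q"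
  using ex_rank_less[of l r "\<lambda>i. X i \<omega> \<noteq> s"] by (cases "l = k") (auto simp: visit_def intro: less_imp_le)

lemma measurable_reduction_index [measurable]:
  "reduction_index s X k \<in> measurable M (count_space UNIV)"
  unfolding reduction_index_def[abs_def] by (rule measurable_enumerate) measurable

lemma measurable_reduced_X: "reduced_X s X k \<in> measurable M (count_space UNIV)"
  unfolding reduced_X_def[abs_def]
  by (rule measurable_compose_countable[where f="\<lambda>n \<omega>. X n \<omega>"]) (auto intro: X_measurable)

lemma measurable_reduced_T: "reduced_T s X T k \<in> borel_measurable M"
  unfolding reduced_T_def[abs_def]
  by (rule measurable_compose_countable[where f="\<lambda>n \<omega>. T n \<omega>"]) auto

section \<open>Histories of the censored process\<close>

abbreviation reduced_history :: "'b \<Rightarrow> nat \<Rightarrow> 'a measure" where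
  "reduced_history s k \<equiv> process_history M (reduced_X s X) (reduced_T s X T) k"

lemma reduced_history_subset: "sets (reduced_history s k) \<subseteq> sets M"
  by (intro sets_process_history_subset measurable_reduced_X measurable_reduced_T)

text \<open>The analogue for the random index of the \<open>k\<close>-th visit of a fact about
  stopping times: what is known at that index becomes, where the index equals \<open>r\<close>, an
  event of \<open>history r\<close>.\<close>

lemma reduced_history_visit:
  assumes "A \<in> sets (reduced_history s k)"
  shows "A \<inter> visit s k r \<in> sets (history r)"
proof -
  have generator: "A \<inter> visit s k r \<in> sets (history r)"
    if l: "l \<le> k" and A: "\<And>q. q \<le> r \<Longrightarrow> \<exists>G\<in>sets (history r). A \<inter> visit s l q = G \<inter> visit s l q" for A l
  proof -
    obtain G where G: "\<And>q. q \<le> r \<Longrightarrow> G q \<in> sets (history r)"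
      "\<And>q. q \<le> r \<Longrightarrow> A \<inter> visit s l q = G q \<inter> visit s l q"
      using A by metis
    \<comment> \<open>If the \<open>k\<close>-th visit is at \<open>r\<close>, then the
      \<open>l\<close>-th took place at some \<open>q \<le> r\<close>, where the reduced variables
      are \<open>X q\<close> and \<open>T q\<close>.\<close>
    have "A \<inter> visit s k r = (\<Union>q\<in>{..r}. A \<inter> visit s l q) \<inter> visit s k r"
      using visit_earlier[OF _ l] by blast
    also have "\<dots> = (\<Union>q\<in>{..r}. G q \<inter> visit s l q) \<inter> visit s k r"
      using G(2) by simp
    also have "\<dots> \<in> sets (history r)"
      using G(1) visit_history sets_history_mono
      by (intro sets.Int sets.finite_UN finite_atMost) (auto simp: subset_iff)
    finally show ?thesis .
  qed
  show ?thesis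
    using assms unfolding sets_process_history[of M "reduced_X s X"]
  proof (induction rule: sigma_sets.induct)
    case (Basic A)
    then consider l x where "l \<le> k" "A = reduced_X s X l -` {x} \<inter> space M"
      | l B where "l \<le> k" "B \<in> sets borel" "A = reduced_T s X T l -` B \<inter> space M"
      by blast
    then show ?case
    proof cases
      case 1
      show ?thesis
      proof (rule generator[OF 1(1)])
        fix q assume "q \<le> r"
        then show "\<exists>G\<in>sets (history r). A \<inter> visit s l q = G \<inter> visit s l q"
          using pred_history_X[of q r x] reduced_visit(1)
          by (intro bexI[of _ "{\<omega> \<in> space M. X q \<omega> = x}"]) (auto simp: 1(2) pred_def)
      qed
    next
      case 2
      show ?thesis
      proof (rule generator[OF 2(1)])
        fix q assume "q \<le> r"
        then show "\<exists>G\<in>sets (history r). A \<inter> visit s l q = G \<inter> visit s l q"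
          using measurable_sets[OF measurable_history_T 2(2), of q r] reduced_visit(2)
          by (intro bexI[of _ "T q -` B \<inter> space M"]) (auto simp: 2(3))
      qed
    qed
  next
    case Empty
    then show ?case by simp
  next
    case (Compl A)
    have "(space M - A) \<inter> visit s k r = visit s k r - A \<inter> visit s k r"
      by (auto simp: visit_def)
    with sets.Diff[OF visit_history Compl(2)] show ?case
      by (simp only:)
  next
    case (Union A)
    have "\<Union> (range A) \<inter> visit s k r = (\<Union>i. A i \<inter> visit s k r)"
      by auto
    moreover have "(\<Union>i. A i \<inter> visit s k r) \<in> sets (history r)"
      using Union(2) by (intro sets.countable_UN) auto
    ultimately show ?case
      by (simp only:)
  qed
qed

section \<open>Excursions through the removed state and the law of a censored step\<close>

lemma AE_infinite_outside:
  assumes s: "s \<in> S"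
  shows "AE \<omega> in M. infinite {k. X k \<omega> \<noteq> s}"
proof -
  obtain j where j: "j \<in> S" "j \<noteq> s"
    using S_nontrivial[of s] s by blast
  show ?thesis
    using AE_infinitely_often
  proof eventually_elim
    case (elim \<omega>)
    then have "infinite {k. X k \<omega> = j}" using j by blast
    then show ?case
      by (rule infinite_super[rotated]) (use j in auto)
  qed
qed

lemma AE_visit:
  assumes s: "s \<in> S"
  shows "AE \<omega> in M. \<exists>r. \<omega> \<in> visit s k r"
  using AE_infinite_outside[OF s] AE_space
proof eventually_elim
  case (elim \<omega>)
  then show ?case
    using enumerate_in_set[of "{k. X k \<omega> \<noteq> s}" k] card_less_enumerate[of "{k. X k \<omega> \<noteq> s}" k]
    by (auto simp: visit_def)
qed

text \<open>For fixed \<open>r\<close> these events partition almost all paths by the number of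
  visits to \<open>s\<close> directly after step \<open>r\<close>. When step \<open>r\<close> is the
  \<open>k\<close>-th visit outside \<open>s\<close>, the next one is then at a deterministic
  index.\<close>

definition run :: "'b \<Rightarrow> nat \<Rightarrow> nat \<Rightarrow> 'a set" where
  "run s r m = {\<omega> \<in> space M. (\<forall>q\<in>{r<..r+m}. X q \<omega> = s) \<and> X (Suc (r+m)) \<omega> \<noteq> s}"

lemma run_sets [measurable]: "run s r m \<in> sets M"
  by (simp add: run_def)

lemma disjoint_run: "disjoint_family (run s r)"
proof -
  have "m = m'" if "\<omega> \<in> run s r m" "\<omega> \<in> run s r m'" for \<omega> m m'
  proof (rule ccontr)
    assume "m \<noteq> m'"
    then consider "m < m'" | "m' < m" by linarith
    then show False
    proof cases
      case 1
      then have "Suc (r + m) \<in> {r<..r+m'}" by auto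
      with that show False unfolding run_def by blast
    next
      case 2
      then have "Suc (r + m') \<in> {r<..r+m}" by auto
      with that show False unfolding run_def by blast
    qed
  qed
  then show ?thesis
    by (auto simp: disjoint_family_on_def)
qed

lemma AE_run:
  assumes s: "s \<in> S"
  shows "AE \<omega> in M. \<exists>m. \<omega> \<in> run s r m"
  using AE_infinite_outside[OF s] AE_space
proof eventually_elim
  case (elim \<omega>)
  define q where "q = (LEAST q. q > r \<and> X q \<omega> \<noteq> s)"
  have ex: "\<exists>q. q > r \<and> X q \<omega> \<noteq> s"
    using elim(1) by (auto simp: infinite_nat_iff_unbounded)
  have q: "q > r" "X q \<omega> \<noteq> s"
    using LeastI_ex[OF ex] by (auto simp: q_def)
  have "X l \<omega> = s" if "r < l" "l < q" for l
    using not_less_Least[of l "\<lambda>q. q > r \<and> X q \<omega> \<noteq> s"] that by (auto simp: q_def)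
  \<comment> \<open>The number of indices strictly between \<open>r\<close> and
    \<open>q\<close>.\<close>
  then have "\<omega> \<in> run s r (q - Suc r)"
    using q elim(2) by (auto simp: run_def)
  then show ?case by blast
qed

lemma visit_run:
  assumes "\<omega> \<in> visit s k r" "\<omega> \<in> run s r m"
  shows "\<omega> \<in> visit s (Suc k) (Suc (r + m))"
proof -
  have "{l. l < Suc (r + m) \<and> X l \<omega> \<noteq> s} = insert r {l. l < r \<and> X l \<omega> \<noteq> s}"
    using assms by (auto simp: visit_def run_def not_less_iff_gr_or_eq less_Suc_eq_le)
  then show ?thesis
    using assms by (auto simp: visit_def run_def)
qed

lemma reduced_step_emeasure:
  assumes s: "s \<in> S" and A: "A \<in> sets (reduced_history s k)"
    and ij: "i \<in> S - {s}" "j \<in> S - {s}" and [measurable]: "B \<in> sets borel"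
  shows "emeasure M (A \<inter> {\<omega> \<in> space M. reduced_X s X k \<omega> = i \<and> reduced_X s X (Suc k) \<omega> = j \<and>
      reduced_T s X T (Suc k) \<omega> - reduced_T s X T k \<omega> \<in> B})
    = emeasure M (A \<inter> {\<omega> \<in> space M. reduced_X s X k \<omega> = i}) * emeasure (reduced_law s i j) B"
proof -
  let ?I = "{\<omega> \<in> space M. reduced_X s X k \<omega> = i}"
  let ?E = "{\<omega> \<in> space M. reduced_X s X k \<omega> = i \<and> reduced_X s X (Suc k) \<omega> = j \<and>
      reduced_T s X T (Suc k) \<omega> - reduced_T s X T k \<omega> \<in> B}"
  note measurable_reduced_X [measurable] measurable_reduced_T [measurable]
  have [measurable]: "A \<in> sets M"
    using A reduced_history_subset by blast
  have [measurable]: "?I \<in> sets M" "?E \<in> sets M"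
    by measurable
  have fixed: "emeasure M (A \<inter> ?E \<inter> visit s k r) = emeasure M (A \<inter> ?I \<inter> visit s k r) * emeasure (reduced_law s i j) B" for r
  proof -
    let ?A = "A \<inter> ?I \<inter> visit s k r"
    \<comment> \<open>On the visit event the reduced state is \<open>X r\<close>, so the whole event
      belongs to \<open>history r\<close> and \<open>sojourn_emeasure\<close> becomes
      applicable.\<close>
    have "?A = (A \<inter> visit s k r) \<inter> {\<omega> \<in> space M. X r \<omega> = i}"
      using reduced_visit(1) by (auto simp: visit_def)
    also have "\<dots> \<in> sets (history r)"
      using reduced_history_visit[OF A] pred_history_X[of r r i] by (auto simp: pred_def)
    finally have A': "?A \<in> sets (history r)" .
    have "emeasure M (A \<inter> ?E \<inter> visit s k r) = (\<Sum>m. emeasure M (A \<inter> ?E \<inter> visit s k r \<inter> run s r m))"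
      using AE_run[OF s, of r] by (intro emeasure_eq_suminf_Int disjoint_run) auto
    also have "\<dots> = (\<Sum>m. emeasure M (?A \<inter> {\<omega> \<in> space M. (\<forall>q\<in>{r<..r+m}. X q \<omega> = s) \<and> X (Suc (r+m)) \<omega> = j \<and>
      T (Suc (r+m)) \<omega> - T r \<omega> \<in> B}))"
    proof (rule suminf_cong)
      fix m
      \<comment> \<open>As \<open>j\<close> differs from \<open>s\<close>, arriving in
        \<open>j\<close> ends the run; the length \<open>m\<close> is thus forced.\<close>
      have run: "\<omega> \<in> run s r m" if "\<omega> \<in> space M" "\<forall>q\<in>{r<..r+m}. X q \<omega> = s" "X (Suc (r+m)) \<omega> = j" for \<omega>
        using that ij(2) by (auto simp: run_def)
      have "A \<inter> ?E \<inter> visit s k r \<inter> run s r m = ?A \<inter> {\<omega> \<in> space M. (\<forall>q\<in>{r<..r+m}. X q \<omega> = s) \<and>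
          X (Suc (r+m)) \<omega> = j \<and> T (Suc (r+m)) \<omega> - T r \<omega> \<in> B}" (is "?L = ?R")
      proof (rule Set.set_eqI)
        fix \<omega>
        show "\<omega> \<in> ?L \<longleftrightarrow> \<omega> \<in> ?R"
          using reduced_visit[of \<omega> s k r] visit_run[of \<omega> s k r m] reduced_visit[of \<omega> s "Suc k" "Suc (r + m)"]
            run[of \<omega>]
          by (auto simp: run_def)
      qed
      then show "emeasure M ?L = emeasure M ?R"
        by (simp only:)
    qed
    also have "\<dots> = (\<Sum>m. emeasure M ?A * emeasure (sojourn s m i j) B)"
    proof (rule suminf_cong)
      fix m
      have "X r \<omega> = i" if "\<omega> \<in> ?A" for \<omega>
        using that reduced_visit(1)[of \<omega> s k r] by auto
      then show "emeasure M (?A \<inter> {\<omega> \<in> space M. (\<forall>q\<in>{r<..r+m}. X q \<omega> = s) \<and> X (Suc (r+m)) \<omega> = j \<and>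
          T (Suc (r+m)) \<omega> - T r \<omega> \<in> B}) = emeasure M ?A * emeasure (sojourn s m i j) B"
        using ij by (intro sojourn_emeasure[OF s A']) auto
    qed
    finally show ?thesis
      by (simp add: emeasure_reduced_law)
  qed
  have "emeasure M (A \<inter> ?E) = (\<Sum>r. emeasure M (A \<inter> ?E \<inter> visit s k r))"
    using AE_visit[OF s, of k] by (intro emeasure_eq_suminf_Int disjoint_visit) auto
  also have "\<dots> = (\<Sum>r. emeasure M (A \<inter> ?I \<inter> visit s k r)) * emeasure (reduced_law s i j) B"
    by (simp only: fixed ennreal_suminf_multc)
  also have "(\<Sum>r. emeasure M (A \<inter> ?I \<inter> visit s k r)) = emeasure M (A \<inter> ?I)"
    using AE_visit[OF s, of k] by (intro emeasure_eq_suminf_Int[symmetric] disjoint_visit) auto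
  finally show ?thesis .
qed

section \<open>The censored process is a Markov renewal process\<close>

lemma AE_reduced_X_in:
  assumes s: "s \<in> S"
  shows "AE \<omega> in M. reduced_X s X k \<omega> \<in> S - {s}"
proof -
  have "AE \<omega> in M. \<forall>k. X k \<omega> \<in> S"
    using X_in_S by (simp add: AE_all_countable)
  then show ?thesis
    using AE_infinite_outside[OF s]
  proof eventually_elim
    case (elim \<omega>)
    then show ?case
      using enumerate_in_set[OF elim(2), of k] by (simp add: reduced_X_def reduction_index_def)
  qed
qed

lemma AE_reduced_T_mono:
  assumes s: "s \<in> S"
  shows "AE \<omega> in M. reduced_T s X T k \<omega> \<le> reduced_T s X T (Suc k) \<omega>"
proof -
  have "AE \<omega> in M. \<forall>k. T k \<omega> \<le> T (Suc k) \<omega>"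
    using T_mono by (simp add: AE_all_countable)
  then show ?thesis
    using AE_infinite_outside[OF s]
  proof eventually_elim
    case (elim \<omega>)
    then show ?case
      using enumerate_mono[of k "Suc k" "{k. X k \<omega> \<noteq> s}"]
        lift_Suc_mono_le[of "\<lambda>k. T k \<omega>" "enumerate {k. X k \<omega> \<noteq> s} k" "enumerate {k. X k \<omega> \<noteq> s} (Suc k)"]
      by (simp add: reduced_T_def reduction_index_def)
  qed
qed

lemma markov_renewal_process_reduced:
  assumes s: "s \<in> S"
  shows "markov_renewal_process M (S - {s}) (reduced_kernel s) (reduced_X s X) (reduced_T s X T)"
proof unfold_locales
  show "finite (S - {s})" using finite_S by simp
  show "semi_markov_kernel (S - {s}) (reduced_kernel s)"
    using s by (rule semi_markov_kernel_reduced)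
  show "reduced_X s X k \<in> measurable M (count_space UNIV)" for k
    by (rule measurable_reduced_X)
  show "reduced_T s X T k \<in> borel_measurable M" for k
    by (rule measurable_reduced_T)
  show "AE \<omega> in M. reduced_X s X k \<omega> \<in> S - {s}" for k
    using s by (rule AE_reduced_X_in)
  show "AE \<omega> in M. reduced_T s X T k \<omega> \<le> reduced_T s X T (Suc k) \<omega>" for k
    using s by (rule AE_reduced_T_mono)
  note measurable_reduced_X [measurable] measurable_reduced_T [measurable]
  fix k j t assume j: "j \<in> S - {s}"
  let ?X = "reduced_X s X" and ?T = "reduced_T s X T" and ?Q = "reduced_kernel s"
  let ?E = "{\<omega> \<in> space M. ?X (Suc k) \<omega> = j \<and> ?T (Suc k) \<omega> - ?T k \<omega> \<le> t}"
  let ?I = "\<lambda>i. {\<omega> \<in> space M. ?X k \<omega> = i}"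
  have [measurable]: "?E \<in> sets M" "?I i \<in> sets M" for i
    by measurable
  have g: "?Q (?X k \<omega>) j t = (\<Sum>i\<in>S - {s}. indicator (?I i) \<omega> * ?Q i j t)" if "\<omega> \<in> space M" for \<omega>
  proof -
    have "(\<Sum>i\<in>S - {s}. indicator (?I i) \<omega> * ?Q i j t) = (\<Sum>i\<in>S - {s}. if ?X k \<omega> = i then ?Q i j t else 0)"
      using that by (intro sum.cong) (auto simp: indicator_def)
    also have "\<dots> = ?Q (?X k \<omega>) j t"
      using finite_S by (auto simp: reduced_kernel_def)
    finally show ?thesis by simp
  qed
  interpret H: finite_measure_subalgebra M "reduced_history s k"
    by unfold_locales (use reduced_history_subset in \<open>auto simp: subalgebra_def\<close>)
  have I_history: "?I i \<in> sets (reduced_history s k)" for i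
  proof -
    have "?I i = ?X k -` {i} \<inter> space M" by auto
    then show ?thesis
      unfolding sets_process_history by (intro sigma_sets.Basic) blast
  qed
  show "AE \<omega> in M. real_cond_exp M (reduced_history s k) (indicator ?E) \<omega> = ?Q (?X k \<omega>) j t"
  proof (rule H.real_cond_exp_charact)
    show "integrable M (indicator ?E :: 'a \<Rightarrow> real)"
      by (simp add: emeasure_eq_measure)
    have "integrable M (\<lambda>\<omega>. \<Sum>i\<in>S - {s}. indicator (?I i) \<omega> * ?Q i j t)"
      by (intro Bochner_Integration.integrable_sum integrable_mult_left) (simp add: emeasure_eq_measure)
    then show "integrable M (\<lambda>\<omega>. ?Q (?X k \<omega>) j t)"
      by (subst Bochner_Integration.integrable_cong[OF refl g])
    have "(\<lambda>\<omega>. \<Sum>i\<in>S - {s}. indicator (?I i) \<omega> * ?Q i j t) \<in> borel_measurable (reduced_history s k)"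
      by (intro borel_measurable_sum borel_measurable_times borel_measurable_indicator I_history) auto
    then show "(\<lambda>\<omega>. ?Q (?X k \<omega>) j t) \<in> borel_measurable (reduced_history s k)"
      by (subst measurable_cong[OF g]) auto
    fix A assume A: "A \<in> sets (reduced_history s k)"
    have [measurable]: "A \<in> sets M"
      using A reduced_history_subset by blast
    have step: "measure M (A \<inter> ?I i \<inter> ?E) = measure M (A \<inter> ?I i) * ?Q i j t" if i: "i \<in> S - {s}" for i
    proof -
      have "A \<inter> ?I i \<inter> ?E = A \<inter> {\<omega> \<in> space M. ?X k \<omega> = i \<and> ?X (Suc k) \<omega> = j \<and> ?T (Suc k) \<omega> - ?T k \<omega> \<in> {..t}}"
        by auto
      then show ?thesis
        using reduced_step_emeasure[OF s A i j, of "{..t}"] i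
        by (simp add: measure_def enn2real_mult reduced_kernel_def)
    qed
    \<comment> \<open>Split by the current reduced state: on each piece the kernel value is constant
      and \<open>step\<close> applies.\<close>
    have "(\<integral>\<omega>\<in>A. (indicator ?E \<omega> :: real) \<partial>M) =
        (\<integral>\<omega>. (\<Sum>i\<in>S - {s}. indicator (A \<inter> ?I i \<inter> ?E) \<omega>) \<partial>M)"
      unfolding set_lebesgue_integral_def
    proof (rule integral_cong_AE)
      show "AE \<omega> in M. indicator A \<omega> *\<^sub>R (indicator ?E \<omega> :: real) = (\<Sum>i\<in>S - {s}. indicator (A \<inter> ?I i \<inter> ?E) \<omega>)"
        using AE_reduced_X_in[OF s, of k] AE_space
      proof eventually_elim
        case (elim \<omega>)
        have "(\<Sum>i\<in>S - {s}. indicator (A \<inter> ?I i \<inter> ?E) \<omega> :: real) =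
            (\<Sum>i\<in>S - {s}. if ?X k \<omega> = i then indicator A \<omega> * indicator ?E \<omega> else 0)"
          using elim by (intro sum.cong) (auto simp: indicator_def)
        then show ?case
          using elim finite_S by simp
      qed
    qed measurable
    also have "\<dots> = (\<Sum>i\<in>S - {s}. measure M (A \<inter> ?I i \<inter> ?E))"
      by (subst Bochner_Integration.integral_sum) (auto simp: emeasure_eq_measure)
    also have "\<dots> = (\<Sum>i\<in>S - {s}. measure M (A \<inter> ?I i) * ?Q i j t)"
      by (intro sum.cong step refl)
    also have "\<dots> = (\<integral>\<omega>. (\<Sum>i\<in>S - {s}. indicator (A \<inter> ?I i) \<omega> * ?Q i j t) \<partial>M)"
      by (subst Bochner_Integration.integral_sum) (auto simp: emeasure_eq_measure)
    also have "\<dots> = (\<integral>\<omega>\<in>A. ?Q (?X k \<omega>) j t \<partial>M)"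
      unfolding set_lebesgue_integral_def
      by (intro Bochner_Integration.integral_cong refl)
        (simp add: g sum_distrib_left indicator_inter_arith mult.assoc)
    finally show "(\<integral>\<omega>\<in>A. indicator ?E \<omega> \<partial>M) = (\<integral>\<omega>\<in>A. ?Q (?X k \<omega>) j t \<partial>M)" .
  qed
qed

end

subsection \<open>Mean first passage times\<close>

lemma taboo_step_ennreal:
  assumes "\<And>l. l \<in> S - {j} \<Longrightarrow> 0 \<le> p i l" "\<And>l. l \<in> S - {j} \<Longrightarrow> 0 \<le> y l"
  shows "taboo_step S p j (\<lambda>l. ennreal (y l)) i = ennreal (\<Sum>l\<in>S - {j}. p i l * y l)"
  unfolding taboo_step_def using assms
  by (subst sum_ennreal[symmetric]) (auto simp: ennreal_mult)

text \<open>The equation at \<open>s\<close> is solved for \<open>y s\<close> and substituted into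
  row \<open>l\<close>. Only that one equation is assumed, so the identity serves for passing from
  the full system to the reduced one and back.\<close>

lemma state_elimination:
  fixes p :: "'s \<Rightarrow> 's \<Rightarrow> real"
  assumes fin: "finite S" and s: "s \<in> S" "s \<noteq> j" and \<sigma>: "\<sigma> \<noteq> 0"
    and y: "y s * \<sigma> = \<mu> s + (\<Sum>h\<in>S - {s} - {j}. p s h * y h)"
  shows "\<mu> l + (\<Sum>h\<in>S - {j}. p l h * y h) =
    (\<mu> l + p l s * \<mu> s / \<sigma>) + (\<Sum>h\<in>S - {s} - {j}. (p l h + p l s * p s h / \<sigma>) * y h)"
proof -
  have eq: "S - {j} - {s} = S - {s} - {j}" by auto
  have "(\<Sum>h\<in>S - {j}. p l h * y h) = p l s * y s + (\<Sum>h\<in>S - {s} - {j}. p l h * y h)"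
    using fin s by (subst sum.remove[of _ s]) (auto simp: eq)
  moreover have "y s = \<mu> s / \<sigma> + (\<Sum>h\<in>S - {s} - {j}. p s h * y h) / \<sigma>"
    using y \<sigma> by (simp add: field_simps)
  moreover have "(\<Sum>h\<in>S - {s} - {j}. (p l h + p l s * p s h / \<sigma>) * y h) =
      (\<Sum>h\<in>S - {s} - {j}. p l h * y h) + p l s * ((\<Sum>h\<in>S - {s} - {j}. p s h * y h) / \<sigma>)"
    by (simp add: sum.distrib sum_distrib_left sum_divide_distrib distrib_right mult.assoc)
  ultimately show ?thesis
    by (simp add: distrib_left)
qed

context markov_renewal_process
begin

text \<open>Recurrence and finiteness appear as hypotheses in place of irreducibility, which makes
  the result applicable to a reduced process on a single state.\<close>

lemma mean_first_passage_time_equation: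
  assumes pos: "\<And>i. i \<in> S \<Longrightarrow> measure M {\<omega> \<in> space M. X 0 \<omega> = i} > 0"
    and hit: "AE \<omega> in M. \<exists>k\<ge>1. X k \<omega> = j"
    and fin: "\<And>i. i \<in> S \<Longrightarrow> mean_holding_time S Q i \<noteq> \<infinity>"
      "\<And>i. i \<in> S \<Longrightarrow> mean_first_passage_time M X T i j \<noteq> \<infinity>"
    and i: "i \<in> S"
  shows "enn2real (mean_first_passage_time M X T i j) = enn2real (mean_holding_time S Q i)
    + (\<Sum>k\<in>S - {j}. transition_prob Q i k * enn2real (mean_first_passage_time M X T k j))"
proof -
  let ?m = "\<lambda>l. mean_first_passage_time M X T l j"
  let ?\<mu> = "mean_holding_time S Q"
  let ?v = "\<lambda>l. \<Sum>k. (taboo_step S (transition_prob Q) j ^^ k) ?\<mu> l"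
  have m: "?m l = ?v l" if "l \<in> S" for l
    using that pos hit by (intro mean_first_passage_time_eq_suminf) auto
  have "?m i = ?\<mu> i + taboo_step S (transition_prob Q) j ?v i"
    using m[OF i] taboo_suminf_unfold[of S "transition_prob Q" j ?\<mu> i] by (simp only:)
  also have "taboo_step S (transition_prob Q) j ?v i = taboo_step S (transition_prob Q) j (\<lambda>l. ennreal (enn2real (?m l))) i"
    using fin(2) by (intro taboo_step_cong) (simp add: ennreal_enn2real_if m[symmetric])
  also have "\<dots> = ennreal (\<Sum>k\<in>S - {j}. transition_prob Q i k * enn2real (?m k))"
    using i transition_prob_nonneg by (intro taboo_step_ennreal) auto
  also have "?\<mu> i = ennreal (enn2real (?\<mu> i))"
    using fin(1)[OF i] by (simp add: ennreal_enn2real_if)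
  also have "\<dots> + ennreal (\<Sum>k\<in>S - {j}. transition_prob Q i k * enn2real (?m k)) =
      ennreal (enn2real (?\<mu> i) + (\<Sum>k\<in>S - {j}. transition_prob Q i k * enn2real (?m k)))"
    using i transition_prob_nonneg by (intro ennreal_plus[symmetric] sum_nonneg mult_nonneg_nonneg) auto
  finally show ?thesis
    using i transition_prob_nonneg
    by (simp only:) (intro enn2real_ennreal add_nonneg_nonneg sum_nonneg mult_nonneg_nonneg; auto)
qed

end

context irreducible_markov_renewal_process
begin

lemma AE_hit:
  assumes "j \<in> S"
  shows "AE \<omega> in M. \<exists>k\<ge>1. X k \<omega> = j"
  using AE_recurrent[OF assms] by eventually_elim (metis One_nat_def Suc_leI)

lemma AE_reduced_hit:
  assumes s: "s \<in> S" and j: "j \<in> S - {s}"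
  shows "AE \<omega> in M. \<exists>k\<ge>1. reduced_X s X k \<omega> = j"
  using AE_infinitely_often AE_infinite_outside[OF s]
proof eventually_elim
  case (elim \<omega>)
  let ?A = "{k. X k \<omega> \<noteq> s}"
  have "infinite {k. X k \<omega> = j}"
    using elim(1) j by blast
  \<comment> \<open>Going beyond the first index outside \<open>s\<close> guarantees a reduced index
    of at least 1.\<close>
  then obtain q where q: "q > enumerate ?A 0" "X q \<omega> = j"
    by (auto simp: infinite_nat_iff_unbounded)
  then have "q \<in> ?A" using j by auto
  then obtain k where k: "enumerate ?A k = q"
    using enumerate_Ex[OF elim(2)] by blast
  then have "k \<ge> 1"
    using q(1) by (cases k) auto
  then show ?case
    using k q(2) by (auto simp: reduced_X_def reduction_index_def)
qed

lemma mean_first_passage_time_finite: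
  assumes i: "i \<in> S" and j: "j \<in> S" and pos: "measure M {\<omega> \<in> space M. X 0 \<omega> = i} > 0"
    and fin: "\<And>l. l \<in> S \<Longrightarrow> mean_holding_time S Q l \<noteq> \<infinity>"
  shows "mean_first_passage_time M X T i j \<noteq> \<infinity>"
  using assms by (simp only: mean_first_passage_time_eq_suminf[OF i pos AE_hit[OF j]])
    (rule taboo_suminf_finite)

text \<open>A path that starts outside \<open>s\<close> keeps its initial state, so the reduction
  can only add paths to the event.\<close>

lemma reduced_initial_pos:
  assumes i: "i \<noteq> s" and pos: "measure M {\<omega> \<in> space M. X 0 \<omega> = i} > 0"
  shows "measure M {\<omega> \<in> space M. reduced_X s X 0 \<omega> = i} > 0"
proof -
  note measurable_reduced_X [measurable]
  have "reduced_X s X 0 \<omega> = i" if "\<omega> \<in> space M" "X 0 \<omega> = i" for \<omega>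
    using reduced_visit(1)[of \<omega> s 0 0] that i by (auto simp: visit_def)
  then have "measure M {\<omega> \<in> space M. X 0 \<omega> = i} \<le> measure M {\<omega> \<in> space M. reduced_X s X 0 \<omega> = i}"
    by (intro finite_measure_mono) auto
  with pos show ?thesis by simp
qed

text \<open>Both sides are minimal nonnegative solutions of the respective first-passage systems, and
  Gaussian elimination of \<open>s\<close> turns a solution of either system into one of the other.\<close>

lemma mean_first_passage_time_reduced:
  assumes s: "s \<in> S" and i: "i \<in> S - {s}" and j: "j \<in> S - {s}"
    and pos: "measure M {\<omega> \<in> space M. X 0 \<omega> = i} > 0"
    and fin: "\<And>l. l \<in> S \<Longrightarrow> mean_holding_time S Q l \<noteq> \<infinity>"
  shows "mean_first_passage_time M (reduced_X s X) (reduced_T s X T) i j = mean_first_passage_time M X T i j"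
proof -
  interpret R: markov_renewal_process M "S - {s}" "reduced_kernel s" "reduced_X s X" "reduced_T s X T"
    using s by (rule markov_renewal_process_reduced)
  define \<sigma> where "\<sigma> = 1 - p s s"
  have \<sigma>: "\<sigma> > 0"
    using p_self_less_1[OF s] by (simp add: \<sigma>_def)
  let ?p' = "transition_prob (reduced_kernel s)"
  define \<mu> where "\<mu> l = enn2real (mean_holding_time S Q l)" for l
  define \<mu>' where "\<mu>' l = \<mu> l + p l s * \<mu> s / \<sigma>" for l
  have \<mu>: "mean_holding_time S Q l = ennreal (\<mu> l)" if "l \<in> S" for l
    using fin[OF that] by (simp add: \<mu>_def ennreal_enn2real_if)
  have \<mu>0: "0 \<le> \<mu> l" for l by (simp add: \<mu>_def)
  have \<mu>': "mean_holding_time (S - {s}) (reduced_kernel s) l = ennreal (\<mu>' l)" if "l \<in> S - {s}" for l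
    using mean_holding_time_reduced[OF s that] fin s that by (simp add: \<mu>'_def \<mu>_def \<sigma>_def)
  have p0: "0 \<le> p l h" if "l \<in> S" "h \<in> S" for l h
    using that by (rule transition_prob_nonneg)
  have \<mu>'0: "0 \<le> \<mu>' l" if "l \<in> S" for l
    using that \<mu>0 p0 s \<sigma> by (simp add: \<mu>'_def)
  have p': "?p' l h = p l h + p l s * p s h / \<sigma>" if "l \<in> S - {s}" "h \<in> S - {s}" for l h
    unfolding \<sigma>_def by (rule transition_prob_reduced[OF s that])
  define x where "x l = (\<Sum>k. (taboo_step S p j ^^ k) (mean_holding_time S Q) l)" for l
  define x' where "x' l = (\<Sum>k. (taboo_step (S - {s}) ?p' j ^^ k) (mean_holding_time (S - {s}) (reduced_kernel s)) l)" for l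
  define y where "y l = enn2real (x l)" for l
  define y' where "y' l = enn2real (x' l)" for l
  have "x l \<noteq> \<infinity>" if "l \<in> S" for l
    unfolding x_def using that j fin by (intro taboo_suminf_finite) auto
  then have x: "x l = ennreal (y l)" if "l \<in> S" for l
    using that by (simp add: y_def ennreal_enn2real_if)
  have y0: "0 \<le> y l" "0 \<le> y' l" for l
    by (simp_all add: y_def y'_def)
  have y_eq: "y l = \<mu> l + (\<Sum>h\<in>S - {j}. p l h * y h)" if l: "l \<in> S" for l
  proof -
    have "ennreal (y l) = ennreal (\<mu> l) + taboo_step S p j x l"
      using taboo_suminf_unfold[of S p j "mean_holding_time S Q" l] l
      by (simp add: x_def[symmetric] x \<mu>)
    also have "taboo_step S p j x l = taboo_step S p j (\<lambda>h. ennreal (y h)) l"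
      by (intro taboo_step_cong x)
    also have "\<dots> = ennreal (\<Sum>h\<in>S - {j}. p l h * y h)"
      using l p0 y0 by (intro taboo_step_ennreal) auto
    also have "ennreal (\<mu> l) + \<dots> = ennreal (\<mu> l + (\<Sum>h\<in>S - {j}. p l h * y h))"
      using l p0 y0 \<mu>0 by (intro ennreal_plus[symmetric] sum_nonneg mult_nonneg_nonneg) auto
    finally show ?thesis
      using l p0 y0 \<mu>0 by (subst (asm) ennreal_inj) (auto intro!: add_nonneg_nonneg sum_nonneg mult_nonneg_nonneg)
  qed
  have sj: "s \<noteq> j" using j by auto
  have remove: "S - {j} - {s} = S - {s} - {j}" by auto
  have split_s: "(\<Sum>h\<in>S - {j}. f h) = f s + (\<Sum>h\<in>S - {s} - {j}. f h)" for f :: "'b \<Rightarrow> real"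
    using finite_S s j by (subst sum.remove[of _ s]) (auto simp: remove)
  have \<sigma>_mult: "a * \<sigma> = a - p s s * a" for a
    by (simp add: \<sigma>_def algebra_simps)
  have "y s * \<sigma> = \<mu> s + (\<Sum>h\<in>S - {s} - {j}. p s h * y h)"
    using y_eq[OF s] split_s[of "\<lambda>h. p s h * y h"] unfolding \<sigma>_mult by linarith
  then have y_red: "\<mu>' l + (\<Sum>h\<in>S - {s} - {j}. (p l h + p l s * p s h / \<sigma>) * y h) = y l" if "l \<in> S" for l
    using y_eq[OF that] state_elimination[of S s j \<sigma> y \<mu> p l] finite_S s sj \<sigma> by (simp add: \<mu>'_def)
  have taboo': "ennreal (\<mu>' l) + taboo_step (S - {s}) ?p' j (\<lambda>h. ennreal (z h)) l =
      ennreal (\<mu>' l + (\<Sum>h\<in>S - {s} - {j}. (p l h + p l s * p s h / \<sigma>) * z h))"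
    if l: "l \<in> S - {s}" and z: "\<And>h. 0 \<le> z h" for l z
  proof -
    have nonneg: "0 \<le> p l h + p l s * p s h / \<sigma>" if "h \<in> S - {s}" for h
      using that l s p0 \<sigma> by simp
    have "taboo_step (S - {s}) ?p' j (\<lambda>h. ennreal (z h)) l = ennreal (\<Sum>h\<in>S - {s} - {j}. ?p' l h * z h)"
      using l z R.transition_prob_nonneg by (intro taboo_step_ennreal) auto
    also have "(\<Sum>h\<in>S - {s} - {j}. ?p' l h * z h) = (\<Sum>h\<in>S - {s} - {j}. (p l h + p l s * p s h / \<sigma>) * z h)"
      using l by (intro sum.cong refl) (auto simp: p')
    finally have "taboo_step (S - {s}) ?p' j (\<lambda>h. ennreal (z h)) l =
        ennreal (\<Sum>h\<in>S - {s} - {j}. (p l h + p l s * p s h / \<sigma>) * z h)" .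
    moreover have "ennreal (\<mu>' l) + ennreal (\<Sum>h\<in>S - {s} - {j}. (p l h + p l s * p s h / \<sigma>) * z h) =
       ennreal (\<mu>' l + (\<Sum>h\<in>S - {s} - {j}. (p l h + p l s * p s h / \<sigma>) * z h))"
      using l z nonneg \<mu>'0 by (intro ennreal_plus[symmetric] sum_nonneg mult_nonneg_nonneg) auto
    ultimately show ?thesis
      by (simp only:)
  qed
  \<comment> \<open>Elimination makes \<open>x\<close> a solution of the reduced system, so
    minimality bounds \<open>x'\<close>. This also yields the finiteness of
    \<open>x'\<close>.\<close>
  have le1: "x' l \<le> x l" if l: "l \<in> S - {s}" for l
    unfolding x'_def
  proof (rule taboo_suminf_le[OF _ l])
    fix h assume h: "h \<in> S - {s}"
    have "mean_holding_time (S - {s}) (reduced_kernel s) h + taboo_step (S - {s}) ?p' j x h =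
      ennreal (\<mu>' h) + taboo_step (S - {s}) ?p' j (\<lambda>h. ennreal (y h)) h"
      using h x by (intro arg_cong2[where f="(+)"] taboo_step_cong \<mu>') auto
    also have "\<dots> = ennreal (y h)"
      using h y_red[of h] y0 by (simp add: taboo')
    finally show "mean_holding_time (S - {s}) (reduced_kernel s) h + taboo_step (S - {s}) ?p' j x h \<le> x h"
      using h by (simp add: x)
  qed
  have x': "x' l = ennreal (y' l)" if "l \<in> S - {s}" for l
    using le1[OF that] x[of l] that by (auto simp: y'_def ennreal_enn2real_if top_unique)
  \<comment> \<open>Back substitution: at \<open>s\<close> the value is the one forced by the row of
    \<open>s\<close>, with its self-transition moved to the left.\<close>
  define z where "z l = (if l = s then (\<mu> s + (\<Sum>h\<in>S - {s} - {j}. p s h * y' h)) / \<sigma> else y' l)" for l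
  have z0: "0 \<le> z l" for l
    using y0 \<mu>0 p0 s \<sigma> by (auto simp: z_def intro!: divide_nonneg_pos add_nonneg_nonneg sum_nonneg mult_nonneg_nonneg)
  have zy: "(\<Sum>h\<in>S - {s} - {j}. f h * z h) = (\<Sum>h\<in>S - {s} - {j}. f h * y' h)" for f
    by (intro sum.cong) (auto simp: z_def)
  have zs: "z s * \<sigma> = \<mu> s + (\<Sum>h\<in>S - {s} - {j}. p s h * z h)"
    using \<sigma> unfolding zy by (simp add: z_def)
  have z_eq: "\<mu> l + (\<Sum>h\<in>S - {j}. p l h * z h) = z l" if l: "l \<in> S" for l
  proof (cases "l = s")
    case True
    then show ?thesis
      using zs split_s[of "\<lambda>h. p s h * z h"] unfolding \<sigma>_mult by simp
  next
    case False
    with l have l': "l \<in> S - {s}" by simp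
    have "ennreal (y' l) = ennreal (\<mu>' l) + taboo_step (S - {s}) ?p' j x' l"
      using taboo_suminf_unfold[of "S - {s}" ?p' j "mean_holding_time (S - {s}) (reduced_kernel s)" l] l'
      by (simp add: x'_def[symmetric] x' \<mu>')
    also have "taboo_step (S - {s}) ?p' j x' l = taboo_step (S - {s}) ?p' j (\<lambda>h. ennreal (y' h)) l"
      by (intro taboo_step_cong x')
    also have "ennreal (\<mu>' l) + \<dots> = ennreal (\<mu>' l + (\<Sum>h\<in>S - {s} - {j}. (p l h + p l s * p s h / \<sigma>) * y' h))"
      using y0 by (intro taboo'[OF l']) auto
    finally have "y' l = \<mu>' l + (\<Sum>h\<in>S - {s} - {j}. (p l h + p l s * p s h / \<sigma>) * y' h)"
      using l s p0 y0 \<mu>'0 \<sigma>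
      by (subst (asm) ennreal_inj) (auto intro!: add_nonneg_nonneg sum_nonneg mult_nonneg_nonneg divide_nonneg_pos)
    then show ?thesis
      using state_elimination[of S s j \<sigma> z \<mu> p l] finite_S s sj \<sigma> zs False
      by (simp add: \<mu>'_def zy) (simp add: z_def)
  qed
  have le2: "x l \<le> ennreal (z l)" if l: "l \<in> S" for l
    unfolding x_def
  proof (rule taboo_suminf_le[OF _ l, where x="\<lambda>l. ennreal (z l)"])
    fix h assume h: "h \<in> S"
    have "mean_holding_time S Q h + taboo_step S p j (\<lambda>l. ennreal (z l)) h =
      ennreal (\<mu> h) + ennreal (\<Sum>l\<in>S - {j}. p h l * z l)"
      using h p0 z0 by (intro arg_cong2[where f="(+)"] taboo_step_ennreal \<mu>) auto
    also have "\<dots> = ennreal (\<mu> h + (\<Sum>l\<in>S - {j}. p h l * z l))"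
      using h p0 z0 \<mu>0 by (intro ennreal_plus[symmetric] sum_nonneg mult_nonneg_nonneg) auto
    finally show "mean_holding_time S Q h + taboo_step S p j (\<lambda>l. ennreal (z l)) h \<le> ennreal (z h)"
      using z_eq[OF h] by simp
  qed
  \<comment> \<open>Since \<open>i\<close> is not \<open>s\<close>, the bound \<open>z i\<close> is
    just \<open>y' i\<close>.\<close>
  have "x' i = x i"
    using le1[OF i] le2[of i] x'[OF i] i by (auto simp: z_def)
  moreover have "mean_first_passage_time M X T i j = x i"
    unfolding x_def using i j pos by (intro mean_first_passage_time_eq_suminf AE_hit) auto
  moreover have "mean_first_passage_time M (reduced_X s X) (reduced_T s X T) i j = x' i"
    unfolding x'_def using i s j pos
    by (intro R.mean_first_passage_time_eq_suminf AE_reduced_hit reduced_initial_pos) auto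
  ultimately show ?thesis by simp
qed

end

section \<open>Matrix form of the equations and assembly of the result\<close>

lemma first_passage_matrix_equation:
  assumes eq: "\<And>i j. i \<in> {1..n} \<Longrightarrow> j \<in> {1..n} \<Longrightarrow>
    enn2real (mean_first_passage_time M X T i j) = enn2real (mean_holding_time {1..n} Q i)
      + (\<Sum>k\<in>{1..n} - {j}. transition_prob Q i k * enn2real (mean_first_passage_time M X T k j))"
  shows "(1\<^sub>m n - transition_matrix n Q) * first_passage_matrix n M X T
            = outer_product (holding_time_vec n Q) (ones_vec n)
              - transition_matrix n Q * diag_part (first_passage_matrix n M X T)"
    (is "(1\<^sub>m n - ?P) * ?F = ?O - ?P * ?D")
proof -
  have P: "?P \<in> carrier_mat n n" and F: "?F \<in> carrier_mat n n"
    by (auto simp: transition_matrix_def first_passage_matrix_def)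
  have "(1\<^sub>m n - ?P) * ?F = ?F - ?P * ?F"
    using P F by (simp add: minus_mult_distrib_mat[of _ n n])
  also have "\<dots> = ?O - ?P * ?D"
  proof (rule eq_matI)
    have O: "?O \<in> carrier_mat n n"
      by (auto simp: outer_product_def holding_time_vec_def ones_vec_def)
    show "dim_row (?F - ?P * ?F) = dim_row (?O - ?P * ?D)" "dim_col (?F - ?P * ?F) = dim_col (?O - ?P * ?D)"
      using P F O by (auto simp: diag_part_def mat_diag_def)
    fix i j assume "i < dim_row (?O - ?P * ?D)" "j < dim_col (?O - ?P * ?D)"
    then have ij: "i < n" "j < n"
      using P F by (auto simp: diag_part_def mat_diag_def)
    let ?m = "\<lambda>i j. enn2real (mean_first_passage_time M X T i j)"
    have shift: "(\<Sum>k<n. f (Suc k)) = sum f {1..n}" for f :: "nat \<Rightarrow> real"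
      using sum.atLeast_Suc_atMost_Suc_shift[of f 0 "n - 1"] sum.shift_bounds_Suc_ivl[of f 0 n]
      by (simp add: atLeast0LessThan atLeastLessThanSuc_atLeastAtMost)
    have "(?F - ?P * ?F) $$ (i, j) = ?m (Suc i) (Suc j) - (\<Sum>k\<in>{1..n}. transition_prob Q (Suc i) k * ?m k (Suc j))"
      using ij shift[of "\<lambda>k. transition_prob Q (Suc i) k * ?m k (Suc j)"]
      by (simp add: first_passage_matrix_def transition_matrix_def scalar_prod_def atLeast0LessThan)
    \<comment> \<open>The summand at \<open>k = Suc j\<close>, absent from the scalar equation, is
      the entry contributed by the diagonal part of the passage matrix.\<close>
    also have "(\<Sum>k\<in>{1..n}. transition_prob Q (Suc i) k * ?m k (Suc j)) =
        transition_prob Q (Suc i) (Suc j) * ?m (Suc j) (Suc j)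
        + (\<Sum>k\<in>{1..n} - {Suc j}. transition_prob Q (Suc i) k * ?m k (Suc j))"
      using ij by (intro sum.remove) auto
    also have "?m (Suc i) (Suc j) - \<dots> = enn2real (mean_holding_time {1..n} Q (Suc i))
        - transition_prob Q (Suc i) (Suc j) * ?m (Suc j) (Suc j)"
      using eq[of "Suc i" "Suc j"] ij by simp
    also have "\<dots> = (?O - ?P * ?D) $$ (i, j)"
    proof -
      have "?P * ?D = Matrix.mat n n (\<lambda>(i, j). ?P $$ (i, j) * ?F $$ (j, j))"
        unfolding diag_part_def using P F by (subst mat_diag_mult_right[of _ n]) auto
      moreover have "?O $$ (i, j) = enn2real (mean_holding_time {1..n} Q (Suc i))"
        using ij by (simp add: outer_product_def holding_time_vec_def ones_vec_def scalar_prod_def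
            mat_of_cols_def mat_of_rows_def)
      ultimately show ?thesis
        using ij P F O by (simp add: transition_matrix_def first_passage_matrix_def)
    qed
    finally show "(?F - ?P * ?F) $$ (i, j) = (?O - ?P * ?D) $$ (i, j)" .
  qed
  finally show ?thesis .
qed

text \<open>A nonzero entry of a power of the matrix arises from a chain of nonzero transitions, and
  such a chain cannot leave a closed class.\<close>

lemma closed_class_irreducible_matrix:
  assumes irr: "irreducible_matrix (transition_matrix n Q)"
    and C: "closed_class {1..n} (transition_prob Q) C"
  shows "C = {1..n}"
proof -
  let ?P = "transition_matrix n Q"
  have P: "?P \<in> carrier_mat n n"
    by (simp add: transition_matrix_def)
  have reach: "Suc l \<in> C" if "i < n" "Suc i \<in> C" "l < n" "(?P ^\<^sub>m k) $$ (i, l) \<noteq> 0" for i l k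
    using that(3,4)
  proof (induction k arbitrary: l)
    case 0
    then show ?case
      using that P by (auto split: if_splits)
  next
    case (Suc k)
    have "(?P ^\<^sub>m Suc k) $$ (i, l) = (\<Sum>h = 0..<n. (?P ^\<^sub>m k) $$ (i, h) * ?P $$ (h, l))"
      using P Suc.prems that(1) pow_carrier_mat[OF P, of k] by (simp add: scalar_prod_def)
    with Suc.prems obtain h where h: "h < n" "(?P ^\<^sub>m k) $$ (i, h) * ?P $$ (h, l) \<noteq> 0"
      by (metis (no_types, lifting) atLeastLessThan_iff sum.neutral)
    then have "Suc h \<in> C"
      using Suc.IH by auto
    moreover have "transition_prob Q (Suc h) (Suc l) \<noteq> 0"
      using h Suc.prems by (auto simp: transition_matrix_def)
    ultimately show ?case
      using C Suc.prems(1) by (auto simp: closed_class_def)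
  qed
  obtain c where c: "c \<in> C" "c \<in> {1..n}"
    using C unfolding closed_class_def by blast
  have "l \<in> C" if "l \<in> {1..n}" for l
  proof -
    have "c - 1 < n" "l - 1 < n" "Suc (c - 1) = c" "Suc (l - 1) = l"
      using c that by auto
    moreover obtain k where "(?P ^\<^sub>m k) $$ (c - 1, l - 1) > 0"
      using irr \<open>c - 1 < n\<close> \<open>l - 1 < n\<close> P by (auto simp: irreducible_matrix_def)
    ultimately show ?thesis
      using reach[of "c - 1" "l - 1" k] c by simp
  qed
  then show ?thesis
    using C by (auto simp: closed_class_def)
qed

theorem theorem2:
  fixes M :: "'w measure"
    and Q :: "nat \<Rightarrow> nat \<Rightarrow> real \<Rightarrow> real"
    and X :: "nat \<Rightarrow> 'w \<Rightarrow> nat"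
    and T :: "nat \<Rightarrow> 'w \<Rightarrow> real"
    and n N :: nat
  assumes "2 \<le> n" and "n \<le> N"
    and "markov_renewal_process M {1..n} Q X T"
    and "irreducible_matrix (transition_matrix n Q)"
    and "\<forall>i\<in>{1..n}. mean_holding_time {1..n} Q i \<noteq> \<infinity>"
  shows
    "let p = transition_prob Q;
         \<mu> = (\<lambda>i. enn2real (mean_holding_time {1..n} Q i));
         m = (\<lambda>i j. enn2real (mean_first_passage_time M X T i j));
         Sn = (\<Sum>j=1..n-1. p n j);
         X' = reduced_X n X;
         T' = reduced_T n X T;
         passage_times_defined = (\<forall>i\<in>{1..n}. measure M {\<omega> \<in> space M. X 0 \<omega> = i} > 0)
     in
       (passage_times_defined \<longrightarrow>
          (\<forall>i\<in>{1..n}. \<forall>j\<in>{1..n}. mean_first_passage_time M X T i j \<noteq> \<infinity>) \<and>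
          (1\<^sub>m n - transition_matrix n Q) * first_passage_matrix n M X T
            = outer_product (holding_time_vec n Q) (ones_vec n)
              - transition_matrix n Q * diag_part (first_passage_matrix n M X T) \<and>
          (\<forall>i\<in>{1..n}. \<forall>j\<in>{1..n}. m i j = \<mu> i + (\<Sum>k\<in>{1..n} - {j}. p i k * m k j))) \<and>
       Sn = 1 - p n n \<and>
       (\<exists>Q'. markov_renewal_process M {1..n-1} Q' X' T' \<and>
          (\<forall>i\<in>{1..n-1}. \<forall>j\<in>{1..n-1}. transition_prob Q' i j = p i j + p i n * p n j / Sn) \<and>
          (\<forall>i\<in>{1..n-1}. mean_holding_time {1..n-1} Q' i \<noteq> \<infinity> \<and>
             enn2real (mean_holding_time {1..n-1} Q' i) = \<mu> i + p i n * \<mu> n / Sn) \<and>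
          (passage_times_defined \<longrightarrow>
             (\<forall>i\<in>{1..n-1}. \<forall>j\<in>{1..n-1}.
                mean_first_passage_time M X' T' i j = mean_first_passage_time M X T i j) \<and>
             (1\<^sub>m (n-1) - transition_matrix (n-1) Q') * first_passage_matrix (n-1) M X' T'
               = outer_product (holding_time_vec (n-1) Q') (ones_vec (n-1))
                 - transition_matrix (n-1) Q' * diag_part (first_passage_matrix (n-1) M X' T')))"
proof -
  let ?S = "{1..n}" and ?S' = "{1..n-1}"
  interpret markov_renewal_process M ?S Q X T
    by fact
  interpret irreducible_markov_renewal_process M ?S Q X T
  proof unfold_locales
    show "C = ?S" if "closed_class ?S (transition_prob Q) C" for C
      using assms(4) that by (rule closed_class_irreducible_matrix)
    show "?S \<noteq> {j}" for j
    proof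
      assume "?S = {j}"
      then have "1 \<in> {j}" "n \<in> {j}"
        using assms(1) by auto
      with assms(1) show False by simp
    qed
  qed
  have n: "n \<in> ?S" and S': "?S - {n} = ?S'"
    using assms(1) by auto
  have fin: "mean_holding_time ?S Q i \<noteq> \<infinity>" if "i \<in> ?S" for i
    using assms(5) that by blast
  let ?Q' = "reduced_kernel n" and ?X' = "reduced_X n X" and ?T' = "reduced_T n X T"
  define Sn where "Sn = (\<Sum>j=1..n-1. p n j)"
  have Sn: "Sn = 1 - p n n"
    using sum_remove_p[OF n n] by (simp only: S' Sn_def)
  define passage where "passage \<longleftrightarrow> (\<forall>i\<in>?S. measure M {\<omega> \<in> space M. X 0 \<omega> = i} > 0)"
  define \<mu> where "\<mu> i = enn2real (mean_holding_time ?S Q i)" for i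
  define m where "m i j = enn2real (mean_first_passage_time M X T i j)" for i j
  have m_fin: "mean_first_passage_time M X T i j \<noteq> \<infinity>" if passage "i \<in> ?S" "j \<in> ?S" for i j
    using that fin by (intro mean_first_passage_time_finite) (auto simp: passage_def)
  have m_eq: "m i j = \<mu> i + (\<Sum>k\<in>?S - {j}. p i k * m k j)" if passage "i \<in> ?S" "j \<in> ?S" for i j
    unfolding m_def \<mu>_def using that fin m_fin
    by (intro mean_first_passage_time_equation AE_hit) (auto simp: passage_def)
  interpret R: markov_renewal_process M ?S' ?Q' ?X' ?T'
    using markov_renewal_process_reduced[OF n] by (simp only: S')
  have trans': "transition_prob ?Q' i j = p i j + p i n * p n j / Sn" if "i \<in> ?S'" "j \<in> ?S'" for i j
    unfolding Sn using that by (intro transition_prob_reduced[OF n]) (simp_all only: S')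
  have hold': "mean_holding_time ?S' ?Q' i = ennreal (\<mu> i + p i n * \<mu> n / Sn)" if "i \<in> ?S'" for i
  proof -
    have "i \<in> ?S - {n}" using that by (simp only: S')
    then have "mean_holding_time (?S - {n}) ?Q' i = ennreal (\<mu> i + p i n * \<mu> n / Sn)"
      unfolding Sn \<mu>_def using n fin by (intro mean_holding_time_reduced) auto
    then show ?thesis by (simp only: S')
  qed
  have hold'_nonneg: "0 \<le> \<mu> i + p i n * \<mu> n / Sn" if "i \<in> ?S'" for i
    using that n transition_prob_nonneg[of i n] p_self_less_1[OF n] by (auto simp: \<mu>_def Sn)
  have m': "mean_first_passage_time M ?X' ?T' i j = mean_first_passage_time M X T i j"
    if passage "i \<in> ?S'" "j \<in> ?S'" for i j
    using that fin by (intro mean_first_passage_time_reduced[OF n]) (auto simp: passage_def)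
  have m'_eq: "enn2real (mean_first_passage_time M ?X' ?T' i j) = enn2real (mean_holding_time ?S' ?Q' i)
      + (\<Sum>k\<in>?S' - {j}. transition_prob ?Q' i k * enn2real (mean_first_passage_time M ?X' ?T' k j))"
    if passage "i \<in> ?S'" "j \<in> ?S'" for i j
  proof (rule R.mean_first_passage_time_equation)
    show "AE \<omega> in M. \<exists>k\<ge>1. ?X' k \<omega> = j"
      using that(3) by (intro AE_reduced_hit[OF n]) (simp only: S')
    show "mean_holding_time ?S' ?Q' l \<noteq> \<infinity>" if "l \<in> ?S'" for l
      using hold'[OF that] by simp
    fix l assume l: "l \<in> ?S'"
    show "measure M {\<omega> \<in> space M. ?X' 0 \<omega> = l} > 0"
      using l \<open>passage\<close> by (intro reduced_initial_pos) (auto simp: passage_def)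
    \<comment> \<open>Finiteness is inherited through the equality with the original passage
      times.\<close>
    show "mean_first_passage_time M ?X' ?T' l j \<noteq> \<infinity>"
      unfolding m'[OF \<open>passage\<close> l that(3)] using l that by (intro m_fin) auto
  qed (rule that)
  have hold'_real: "mean_holding_time ?S' ?Q' i \<noteq> \<infinity> \<and>
      enn2real (mean_holding_time ?S' ?Q' i) = \<mu> i + p i n * \<mu> n / Sn" if "i \<in> ?S'" for i
    using hold'[OF that] hold'_nonneg[OF that] by (simp del: ennreal_plus)
  have matrix: "(1\<^sub>m n - transition_matrix n Q) * first_passage_matrix n M X T
            = outer_product (holding_time_vec n Q) (ones_vec n)
              - transition_matrix n Q * diag_part (first_passage_matrix n M X T)" if passage
    using m_eq[OF that] unfolding m_def \<mu>_def by (rule first_passage_matrix_equation)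
  have matrix': "(1\<^sub>m (n-1) - transition_matrix (n-1) ?Q') * first_passage_matrix (n-1) M ?X' ?T'
               = outer_product (holding_time_vec (n-1) ?Q') (ones_vec (n-1))
                 - transition_matrix (n-1) ?Q' * diag_part (first_passage_matrix (n-1) M ?X' ?T')" if passage
    using m'_eq[OF that] by (rule first_passage_matrix_equation)
  show ?thesis
    unfolding Let_def
    unfolding passage_def[symmetric] Sn_def[symmetric] \<mu>_def[symmetric] m_def[symmetric]
    using m_fin m_eq matrix Sn R.markov_renewal_process_axioms trans' hold'_real m' matrix'
    by (intro conjI exI[of _ ?Q']) blast+
qed

end
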